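(* Let $(\mathfrak{X},\pi)$, $a$, $s$, $S$, $m$ and $v$ be as in the context, assume (A), (B), (C), and assume furthermore that \[ \sup_{\emptyset\neq\mathfrak{A}\subsetneq\mathfrak{X}}\ \inf_{x\in\mathfrak{A},\,y\notin\mathfrak{A}}\Big(|a_x-a_y|+\langle |S_x-S_y|\rangle\Big)=0, \] the supremum being over measurable subsets $\mathfrak{A}$. Then the set $\mathfrak{S}$ (see context) is a single interval. In particular, there is no point $\tau_0\in\partial\mathfrak{S}$ at which there is $c\in\mathcal{B}(\mathfrak{X},\mathbb{R})$ with $\inf_xc_x>0$ such that $v_x(\tau_0+\omega)=c_x|\omega|^{1/3}+\mathcal{O}(|\omega|^{2/3})$ as $\omega\to0$ uniformly in $x$.
   Context: Let $(\mathfrak{X},\pi)$ be a measure space where $\pi$ is a probability measure; $\mathcal{B}(\mathfrak{X},\mathbb{D})$ denotes bounded measurable $\mathbb{D}$-valued functions with sup norm $\|\cdot\|$; $\langle w\rangle=\int w_x\,\pi(\mathrm{d}x)$. Let $a\in\mathcal{B}(\mathfrak{X},\mathbb{R})$, $s\in\mathcal{B}(\mathfrak{X}^2,[0,\infty))$ symmetric, $(Sw)_x=\int s_{xy}w_y\,\pi(\mathrm{d}y)$, $S_x:=(y\mapsto s_{xy})$. The equation $-1/m(z)=z+a+Sm(z)$, $z\in\mathbb{H}$ (upper half-plane), has a unique solution $m:\mathbb{H}\to\mathcal{B}(\mathfrak{X},\mathbb{H})$, and $m_x(z)=\int\frac{v_x(\mathrm{d}\tau)}{\tau-z}$ for unique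 probability measures $v_x$ on $\mathbb{R}$. Assumptions: (A) there is a symmetric $r\in\mathcal{B}(\mathfrak{X}^2,[0,\infty))$ with $s_{xy}\ge\int r_{xu}r_{uy}\,\pi(\mathrm{d}u)$ and $\inf_x\int r_{xy}\,\pi(\mathrm{d}y)>0$. (B) There is $K\in\mathbb{N}$ with $\inf_{x,y}s^{(K)}_{xy}>0$, $s^{(K)}$ the kernel of $S^K$. (C) $\lim_{\varepsilon\downarrow0}\inf_{x}\int\frac{\pi(\mathrm{d}y)}{\varepsilon+(a_x-a_y)^2+\langle (S_x-S_y)^2\rangle}=\infty$. Under (A)–(C), each $v_x$ has a continuous Lebesgue density $v_x(\tau)$, and the set $\{\tau\in\mathbb{R}:v_x(\tau)>0\}$ does not depend on $x$; it is denoted $\mathfrak{S}$. *)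

theory Defs
  imports "HOL-Probability.Probability"
begin

text \<open>Kernel of the operator S^(n+1), where (S w)_x = \<integral> s x y w y d\<pi>(y).
  kernel_pow_Suc M s 0 = s is the kernel of S^1.\<close>
primrec kernel_pow_Suc :: "'a measure \<Rightarrow> ('a \<Rightarrow> 'a \<Rightarrow> real) \<Rightarrow> nat \<Rightarrow> 'a \<Rightarrow> 'a \<Rightarrow> real" where
  "kernel_pow_Suc M s 0 = s"
| "kernel_pow_Suc M s (Suc n) = (\<lambda>x y. \<integral>u. kernel_pow_Suc M s n x u * s u y \<partial>M)"

definition bdd_meas :: "'a measure \<Rightarrow> ('a \<Rightarrow> real) \<Rightarrow> bool" where
  "bdd_meas M f \<longleftrightarrow> f \<in> borel_measurable M \<and> (\<exists>C. \<forall>x\<in>space M. \<bar>f x\<bar> \<le> C)"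

definition sym_kernel :: "'a measure \<Rightarrow> ('a \<Rightarrow> 'a \<Rightarrow> real) \<Rightarrow> bool" where
  "sym_kernel M s \<longleftrightarrow> (\<lambda>(x,y). s x y) \<in> borel_measurable (M \<Otimes>\<^sub>M M)
     \<and> (\<exists>C. \<forall>x\<in>space M. \<forall>y\<in>space M. 0 \<le> s x y \<and> s x y \<le> C)
     \<and> (\<forall>x\<in>space M. \<forall>y\<in>space M. s x y = s y x)"

end

theory Submission
  imports Defs
begin

text \<open>
  Write \<open>h = Im m\<close>, so that \<open>h / \<bar>m\<bar>\<^sup>2 = Im z + S h\<close>.  Hence \<open>h\<close> is a positive supersolution of
  \<open>\<bar>m\<bar>\<^sup>2 S\<close>, which by the Schur test and (A) bounds \<open>m\<close> in \<open>L\<^sup>2\<close>; comparing \<open>1 / m\<^sub>x\<close> with \<open>1 / m\<^sub>y\<close>,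
  (C) turns this into a bound in supremum norm on the whole upper half-plane.

  Let \<open>f\<^sub>x\<close> vanish at \<open>\<tau>\<close> for one \<open>x\<close>.  By (B) and a Harnack inequality \<open>h\<close> is uniformly small at some
  \<open>z\<^sub>0 = \<tau> + i \<eta>\<close>, so \<open>1 / m(z\<^sub>0)\<close> is nearly real and bounded away from zero.  The hypothesis on
  \<open>a\<close> and \<open>S\<close> excludes a change of sign, i.e. \<open>Re m(z\<^sub>0)\<close> has one sign on the whole space.  If it is
  positive, then \<open>\<bar>m(z)\<bar> < \<bar>m(z\<^sub>0)\<bar>\<close> for all \<open>z\<close> with \<open>Re z\<close> a fixed amount to the left of \<open>\<tau>\<close>, and
  comparing \<open>h(z)\<close> with the supersolution \<open>h(z\<^sub>0)\<close> gives \<open>h(z) = O(Im z)\<close>: all densities vanish to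
  the left of \<open>\<tau>\<close>.  If it is negative, they vanish to the right.
\<close>

section \<open>The equation and the operator S on bounded functions\<close>

lemma (in finite_measure) integrable_bounded:
  fixes f :: "'a \<Rightarrow> 'b::{banach, second_countable_topology}"
  assumes "f \<in> borel_measurable M" "\<And>x. x \<in> space M \<Longrightarrow> norm (f x) \<le> C"
  shows "integrable M f"
  using assms by (intro integrable_const_bound[of _ C]) auto

text \<open>Results in this locale rest on the equation and the stated regularity of
  \<open>m\<close> alone; the representing measures enter only in
  \<open>qve_density\<close>.\<close>

locale qve = prob_space M for M :: "'a measure" +
  fixes a :: "'a \<Rightarrow> real" and s :: "'a \<Rightarrow> 'a \<Rightarrow> real" and m :: "complex \<Rightarrow> 'a \<Rightarrow> complex"
  assumes a_bdd: "bdd_meas M a"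
    and s_ker: "sym_kernel M s"
    and m_meas: "\<And>z. 0 < Im z \<Longrightarrow> m z \<in> borel_measurable M"
    and m_H: "\<And>z x. 0 < Im z \<Longrightarrow> x \<in> space M \<Longrightarrow> 0 < Im (m z x)"
    and m_bdd: "\<And>z. 0 < Im z \<Longrightarrow> \<exists>C. \<forall>x\<in>space M. cmod (m z x) \<le> C"
    and QVE: "\<And>z x. 0 < Im z \<Longrightarrow> x \<in> space M \<Longrightarrow>
               - 1 / m z x = z + of_real (a x) + (\<integral>y. of_real (s x y) * m z y \<partial>M)"
begin

lemma s_pair [measurable]: "(\<lambda>(x, y). s x y) \<in> borel_measurable (M \<Otimes>\<^sub>M M)"
  and a_meas [measurable]: "a \<in> borel_measurable M"
  using s_ker a_bdd by (auto simp: sym_kernel_def bdd_meas_def)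

lemma s_meas [measurable]: "x \<in> space M \<Longrightarrow> s x \<in> borel_measurable M"
  by measurable

lemma s_nonneg: "x \<in> space M \<Longrightarrow> y \<in> space M \<Longrightarrow> 0 \<le> s x y"
  and s_sym: "x \<in> space M \<Longrightarrow> y \<in> space M \<Longrightarrow> s x y = s y x"
  using s_ker by (auto simp: sym_kernel_def)

lemma s_bound:
  obtains C where "0 < C" "\<And>x y. x \<in> space M \<Longrightarrow> y \<in> space M \<Longrightarrow> s x y \<le> C"
proof -
  from s_ker obtain C where "\<forall>x\<in>space M. \<forall>y\<in>space M. 0 \<le> s x y \<and> s x y \<le> C"
    by (auto simp: sym_kernel_def)
  then show thesis
    \<comment> \<open>Taking \<open>max C 1\<close> makes the bound strictly positive, so that it
      can later appear in denominators.\<close>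
    by (intro that[of "max C 1"]) (auto simp: le_max_iff_disj)
qed

lemma a_bound:
  obtains C where "0 < C" "\<And>x. x \<in> space M \<Longrightarrow> \<bar>a x\<bar> \<le> C"
proof -
  from a_bdd obtain C where "\<forall>x\<in>space M. \<bar>a x\<bar> \<le> C"
    by (auto simp: bdd_meas_def)
  then show thesis
    by (intro that[of "max C 1"]) (auto simp: le_max_iff_disj)
qed

lemma integrable_s_mult:
  fixes w :: "'a \<Rightarrow> real"
  assumes x: "x \<in> space M" and w: "w \<in> borel_measurable M" "\<And>y. y \<in> space M \<Longrightarrow> \<bar>w y\<bar> \<le> C"
  shows "integrable M (\<lambda>y. s x y * w y)"
proof -
  obtain B where B: "0 < B" "\<And>x y. x \<in> space M \<Longrightarrow> y \<in> space M \<Longrightarrow> s x y \<le> B"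
    by (rule s_bound) blast
  have [measurable]: "s x \<in> borel_measurable M" "w \<in> borel_measurable M" using x w by auto
  show ?thesis
  proof (rule integrable_bounded)
    fix y assume y: "y \<in> space M"
    have "\<bar>s x y\<bar> * \<bar>w y\<bar> \<le> B * C"
      using x y B s_nonneg w by (intro mult_mono) auto
    then show "norm (s x y * w y) \<le> B * C" by (simp add: abs_mult)
  qed measurable
qed

lemma S_mono:
  assumes x: "x \<in> space M" and w: "w \<in> borel_measurable M" "\<And>y. y \<in> space M \<Longrightarrow> \<bar>w y\<bar> \<le> C"
    and w': "w' \<in> borel_measurable M" "\<And>y. y \<in> space M \<Longrightarrow> \<bar>w' y\<bar> \<le> C'"
    and le: "\<And>y. y \<in> space M \<Longrightarrow> w y \<le> w' y"
  shows "(\<integral>y. s x y * w y \<partial>M) \<le> (\<integral>y. s x y * w' y \<partial>M)"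
  using x le s_nonneg
  by (intro integral_mono integrable_s_mult[OF x w] integrable_s_mult[OF x w'] mult_left_mono) auto

lemma S_nonneg:
  assumes "x \<in> space M" "\<And>y. y \<in> space M \<Longrightarrow> 0 \<le> w y"
  shows "0 \<le> (\<integral>y. s x y * w y \<partial>M)"
  using assms s_nonneg by (intro integral_nonneg_AE) auto

text \<open>The upper half of the Harnack inequality: since \<open>s \<le> B\<close>, the mean of a
  nonnegative \<open>w\<close> controls \<open>S w\<close> at every point.\<close>

lemma S_le:
  assumes B: "\<And>x y. x \<in> space M \<Longrightarrow> y \<in> space M \<Longrightarrow> s x y \<le> B"
    and x: "x \<in> space M" and w: "w \<in> borel_measurable M" "\<And>y. y \<in> space M \<Longrightarrow> 0 \<le> w y \<and> w y \<le> C"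
  shows "(\<integral>y. s x y * w y \<partial>M) \<le> B * (\<integral>y. w y \<partial>M)"
proof -
  have "integrable M w" using w by (intro integrable_bounded[of _ C]) auto
  moreover have "integrable M (\<lambda>y. s x y * w y)"
    using w by (intro integrable_s_mult[OF x, of _ C]) force+
  ultimately have "(\<integral>y. s x y * w y \<partial>M) \<le> (\<integral>y. B * w y \<partial>M)"
    using w x B by (intro integral_mono mult_right_mono integrable_mult_right) auto
  then show ?thesis by simp
qed

section \<open>Pointwise consequences of the equation at a fixed spectral parameter\<close>

context
  fixes z :: complex
  assumes z: "0 < Im z"
begin

declare m_meas[OF z, measurable]

lemma m_nonzero: "x \<in> space M \<Longrightarrow> m z x \<noteq> 0"
  using m_H[OF z, of x] by auto

lemma Im_bdd: "\<exists>C. \<forall>x\<in>space M. \<bar>Im (m z x)\<bar> \<le> C"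
  using m_bdd[OF z] abs_Im_le_cmod order_trans by blast

lemma Re_bdd: "\<exists>C. \<forall>x\<in>space M. \<bar>Re (m z x)\<bar> \<le> C"
  using m_bdd[OF z] abs_Re_le_cmod order_trans by blast

lemma integrable_s_m:
  assumes x: "x \<in> space M"
  shows "integrable M (\<lambda>y. complex_of_real (s x y) * m z y)"
proof -
  obtain C D where "\<forall>x\<in>space M. \<bar>Re (m z x)\<bar> \<le> C" "\<forall>x\<in>space M. \<bar>Im (m z x)\<bar> \<le> D"
    using Im_bdd Re_bdd by blast
  then have "integrable M (\<lambda>y. s x y * Re (m z y))" "integrable M (\<lambda>y. s x y * Im (m z y))"
    by (auto intro!: integrable_s_mult[OF x])
  from integrable_of_real[OF this(1), where 'a=complex]
    integrable_mult_right[OF integrable_of_real[OF this(2), where 'a=complex], of \<i>]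
  have "integrable M (\<lambda>y. complex_of_real (s x y * Re (m z y)) + \<i> * complex_of_real (s x y * Im (m z y)))"
    by (rule Bochner_Integration.integrable_add)
  then show ?thesis
    by (rule Bochner_Integration.integrable_cong[THEN iffD1, rotated 2]) (auto simp: complex_eq_iff)
qed

lemma Re_S: "x \<in> space M \<Longrightarrow> Re (\<integral>y. complex_of_real (s x y) * m z y \<partial>M) = (\<integral>y. s x y * Re (m z y) \<partial>M)"
  and Im_S: "x \<in> space M \<Longrightarrow> Im (\<integral>y. complex_of_real (s x y) * m z y \<partial>M) = (\<integral>y. s x y * Im (m z y) \<partial>M)"
  using integral_Re[OF integrable_s_m] integral_Im[OF integrable_s_m] by auto

text \<open>Since \<open>Im (- 1 / w) = Im w / \<bar>w\<bar>\<^sup>2\<close>, the imaginary part of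
  the equation is linear in \<open>Im m\<close> once \<open>\<bar>m\<bar>\<close> is regarded as
  given. Every later estimate on \<open>Im m\<close> starts here.\<close>

lemma QVE_Im:
  assumes x: "x \<in> space M"
  shows "Im (m z x) = (cmod (m z x))\<^sup>2 * (Im z + (\<integral>y. s x y * Im (m z y) \<partial>M))"
proof -
  have "Im (- 1 / m z x) = Im (m z x) / (cmod (m z x))\<^sup>2"
    by (simp add: Im_divide cmod_power2)
  then have "Im (m z x) / (cmod (m z x))\<^sup>2 = Im z + (\<integral>y. s x y * Im (m z y) \<partial>M)"
    using Im_S[OF x] arg_cong[OF QVE[OF z x], of Im] by simp
  then show ?thesis
    using m_nonzero[OF x] by (simp add: field_simps)
qed

lemma QVE_Re:
  assumes x: "x \<in> space M"
  shows "- Re (m z x) / (cmod (m z x))\<^sup>2 = Re z + a x + (\<integral>y. s x y * Re (m z y) \<partial>M)"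
proof -
  have "Re (- 1 / m z x) = - Re (m z x) / (cmod (m z x))\<^sup>2"
    by (simp add: Re_divide cmod_power2)
  then show ?thesis
    using Re_S[OF x] arg_cong[OF QVE[OF z x], of Re] by simp
qed

text \<open>The supersolution property of \<open>Im m\<close>, obtained from \<open>QVE_Im\<close>
  by dropping the positive term with \<open>Im z\<close>; \<open>Im_ge\<close> drops the other term
  instead.\<close>

lemma S_Im_le:
  assumes x: "x \<in> space M"
  shows "(cmod (m z x))\<^sup>2 * (\<integral>y. s x y * Im (m z y) \<partial>M) \<le> Im (m z x)"
  using QVE_Im[OF x] z by (simp add: algebra_simps)

lemma Im_ge:
  assumes x: "x \<in> space M"
  shows "Im z * (cmod (m z x))\<^sup>2 \<le> Im (m z x)"
  using QVE_Im[OF x] S_nonneg[OF x, of "\<lambda>y. Im (m z y)"] m_H[OF z]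
  by (simp add: algebra_simps less_imp_le)

text \<open>Combine \<open>Im_ge\<close> with \<open>Im m \<le> \<bar>m\<bar>\<close> and cancel one
  factor \<open>\<bar>m\<bar>\<close>. The bound degenerates at the real axis; it serves for
  integrability and as the starting point of the descent in
  \<open>density_zero_beyond\<close>.\<close>

lemma cmod_m_le:
  assumes x: "x \<in> space M"
  shows "cmod (m z x) \<le> 1 / Im z"
proof -
  have "Im z * (cmod (m z x))\<^sup>2 \<le> cmod (m z x)"
    using Im_ge[OF x] abs_Im_le_cmod[of "m z x"] by linarith
  then show ?thesis
    using m_nonzero[OF x] z by (simp add: power2_eq_square field_simps)
qed

text \<open>The equation read backwards: an upper bound on \<open>m\<close> bounds its right-hand
  side, which is \<open>- 1 / m\<close>.\<close>

lemma cmod_m_ge: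
  assumes B: "\<And>x y. x \<in> space M \<Longrightarrow> y \<in> space M \<Longrightarrow> s x y \<le> B" "0 \<le> B"
    and C: "\<And>x. x \<in> space M \<Longrightarrow> \<bar>a x\<bar> \<le> A" "\<And>x. x \<in> space M \<Longrightarrow> cmod (m z x) \<le> C"
    and x: "x \<in> space M"
  shows "1 / (cmod z + A + B * C) \<le> cmod (m z x)"
proof -
  have "cmod (\<integral>y. complex_of_real (s x y) * m z y \<partial>M) \<le> (\<integral>y. norm (complex_of_real (s x y) * m z y) \<partial>M)"
    by (rule integral_norm_bound)
  also have "\<dots> \<le> (\<integral>y. B * C \<partial>M)"
    using B C s_nonneg x
    by (intro integral_mono integrable_norm integrable_s_m) (auto simp: norm_mult intro!: mult_mono)
  finally have "cmod (\<integral>y. complex_of_real (s x y) * m z y \<partial>M) \<le> B * C"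
    by (simp add: prob_space)
  then have "cmod (- 1 / m z x) \<le> cmod z + A + B * C"
    unfolding QVE[OF z x] using C(1)[OF x]
    by (smt (verit) norm_triangle_ineq norm_of_real)
  moreover have "0 < cmod (m z x)" using m_nonzero[OF x] by simp
  ultimately have "0 < cmod z + A + B * C" "1 \<le> cmod (m z x) * (cmod z + A + B * C)"
    by (auto simp: norm_divide field_simps intro: less_le_trans[of 0 "1 / cmod (m z x)"])
  then show ?thesis by (simp add: divide_le_eq mult.commute)
qed

text \<open>A qualitative bound, depending on \<open>z\<close> through \<open>cmod_m_le\<close>; it
  justifies divisions by \<open>m\<close>. The version uniform in the height is
  \<open>m_lower_bound\<close>.\<close>

lemma cmod_m_pos_lower:
  obtains b where "0 < b" "\<And>x. x \<in> space M \<Longrightarrow> b \<le> cmod (m z x)"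
proof -
  obtain A B where A: "0 < A" "\<And>x. x \<in> space M \<Longrightarrow> \<bar>a x\<bar> \<le> A"
    and B: "0 < B" "\<And>x y. x \<in> space M \<Longrightarrow> y \<in> space M \<Longrightarrow> s x y \<le> B"
    using a_bound s_bound by metis
  have "0 < 1 / (cmod z + A + B * (1 / Im z))"
    using A B z by (simp add: add_nonneg_pos add_pos_pos)
  then show thesis
    using B(1) by (intro that[OF _ cmod_m_ge[OF B(2) _ A(2) cmod_m_le]]) auto
qed

lemma Im_m_pos_lower:
  obtains b where "0 < b" "\<And>x. x \<in> space M \<Longrightarrow> b \<le> Im (m z x)"
proof -
  obtain b where b: "0 < b" "\<And>x. x \<in> space M \<Longrightarrow> b \<le> cmod (m z x)"
    by (rule cmod_m_pos_lower) blast
  have "Im z * b\<^sup>2 \<le> Im (m z x)" if "x \<in> space M" for x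
  proof -
    have "b\<^sup>2 \<le> (cmod (m z x))\<^sup>2" using b that by (intro power_mono) auto
    then have "Im z * b\<^sup>2 \<le> Im z * (cmod (m z x))\<^sup>2" using z by simp
    then show ?thesis using Im_ge[OF that] by linarith
  qed
  then show thesis using that[of "Im z * b\<^sup>2"] z b by auto
qed

end

end

section \<open>The L2 bound\<close>

context prob_space
begin

text \<open>Discriminant argument: the quadratic \<open>t\<^sup>2 * F - 2 * t * P + G\<close> is an
  expected square, hence nonnegative for every \<open>t\<close>.\<close>

lemma expectation_Cauchy_Schwarz:
  fixes f g :: "'a \<Rightarrow> real"
  assumes f: "integrable M (\<lambda>x. (f x)\<^sup>2)" and g: "integrable M (\<lambda>x. (g x)\<^sup>2)"
    and fg: "integrable M (\<lambda>x. f x * g x)"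
  shows "(expectation (\<lambda>x. f x * g x))\<^sup>2 \<le> expectation (\<lambda>x. (f x)\<^sup>2) * expectation (\<lambda>x. (g x)\<^sup>2)"
proof -
  define F P G where "F = expectation (\<lambda>x. (f x)\<^sup>2)" and "P = expectation (\<lambda>x. f x * g x)"
    and "G = expectation (\<lambda>x. (g x)\<^sup>2)"
  have *: "0 \<le> t\<^sup>2 * F - 2 * t * P + G" for t
  proof -
    have "0 \<le> expectation (\<lambda>x. (t * f x - g x)\<^sup>2)" by simp
    also have "\<dots> = expectation (\<lambda>x. t\<^sup>2 * (f x)\<^sup>2 - 2 * t * (f x * g x) + (g x)\<^sup>2)"
      by (simp add: power2_eq_square algebra_simps)
    also have "\<dots> = t\<^sup>2 * F - 2 * t * P + G"
      using f g fg by (simp add: F_def P_def G_def)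
    finally show ?thesis .
  qed
  have "0 \<le> F" by (simp add: F_def)
  show ?thesis
  proof (cases "F = 0")
    case True
    have "P = 0"
    proof (rule ccontr)
      assume "P \<noteq> 0"
      \<comment> \<open>For \<open>F = 0\<close> the polynomial is affine; at this \<open>t\<close>
        it takes the value -1.\<close>
      then show False using *[of "(G + 1) / (2 * P)"] True by (simp add: field_simps)
    qed
    then show ?thesis using True by (simp add: F_def P_def)
  next
    case False
    \<comment> \<open>\<open>P / F\<close> is the minimiser of the quadratic.\<close>
    then have "(P / F)\<^sup>2 * F - 2 * (P / F) * P + G = G - P\<^sup>2 / F"
      by (simp add: power2_eq_square field_simps)
    then have "P\<^sup>2 / F \<le> G" using *[of "P / F"] by linarith
    then have "P\<^sup>2 \<le> F * G" using False \<open>0 \<le> F\<close> by (simp add: pos_divide_le_eq mult.commute)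
    then show ?thesis by (simp add: F_def P_def G_def)
  qed
qed

section \<open>Bounded measurable kernels and Fubini\<close>

context
  fixes k :: "'a \<Rightarrow> 'a \<Rightarrow> real" and C :: real
  assumes k_meas [measurable]: "(\<lambda>(x, y). k x y) \<in> borel_measurable (M \<Otimes>\<^sub>M M)"
    and k_bdd: "\<And>x y. x \<in> space M \<Longrightarrow> y \<in> space M \<Longrightarrow> \<bar>k x y\<bar> \<le> C"
begin

lemma kernel_row_integrable: "x \<in> space M \<Longrightarrow> integrable M (k x)"
  using k_bdd by (intro integrable_bounded[of _ C]) auto

lemma kernel_integral_bdd: "x \<in> space M \<Longrightarrow> \<bar>\<integral>y. k x y \<partial>M\<bar> \<le> C"
proof -
  assume x: "x \<in> space M"
  have "\<bar>\<integral>y. k x y \<partial>M\<bar> \<le> (\<integral>y. \<bar>k x y\<bar> \<partial>M)" by (rule integral_abs_bound)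
  also have "\<dots> \<le> (\<integral>y. C \<partial>M)"
    using x k_bdd by (intro integral_mono integrable_abs kernel_row_integrable) auto
  finally show ?thesis by (simp add: prob_space)
qed

lemma kernel_Fubini: "(\<integral>x. \<integral>y. k x y \<partial>M \<partial>M) = (\<integral>y. \<integral>x. k x y \<partial>M \<partial>M)"
proof -
  interpret P: pair_prob_space M M ..
  have "integrable (M \<Otimes>\<^sub>M M) (\<lambda>(x, y). k x y)"
    using k_bdd by (intro P.P.integrable_bounded[of _ C]) (auto simp: space_pair_measure)
  then show ?thesis by (rule P.Fubini_integral[symmetric])
qed

end

text \<open>Associativity of kernel composition, by Fubini. It moves one factor of a product kernel
  onto the function it acts on, both for the square of \<open>r\<close> and for the powers of
  \<open>S\<close>.\<close>

lemma kernel_comp_apply: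
  fixes q :: "'a \<Rightarrow> 'a \<Rightarrow> real"
  assumes q [measurable]: "(\<lambda>(x, y). q x y) \<in> borel_measurable (M \<Otimes>\<^sub>M M)"
    and q_bdd: "\<And>x y. x \<in> space M \<Longrightarrow> y \<in> space M \<Longrightarrow> \<bar>q x y\<bar> \<le> Q"
    and p [measurable]: "p \<in> borel_measurable M" "\<And>x. x \<in> space M \<Longrightarrow> \<bar>p x\<bar> \<le> P"
    and w [measurable]: "w \<in> borel_measurable M" "\<And>x. x \<in> space M \<Longrightarrow> \<bar>w x\<bar> \<le> W"
  shows "(\<integral>y. (\<integral>u. p u * q u y \<partial>M) * w y \<partial>M) = (\<integral>u. p u * (\<integral>y. q u y * w y \<partial>M) \<partial>M)"
proof -
  have "(\<integral>u. \<integral>y. p u * q u y * w y \<partial>M \<partial>M) = (\<integral>y. \<integral>u. p u * q u y * w y \<partial>M \<partial>M)"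
  proof (rule kernel_Fubini)
    show "\<bar>p u * q u y * w y\<bar> \<le> P * Q * W" if "u \<in> space M" "y \<in> space M" for u y
      using that p(2)[of u] q_bdd[of u y] w(2)[of y]
      by (auto simp: abs_mult intro!: mult_mono order_trans[OF _ p(2)[of u]])
  qed measurable
  moreover have "(\<integral>y. p u * q u y * w y \<partial>M) = p u * (\<integral>y. q u y * w y \<partial>M)" for u
    by (simp add: mult.assoc)
  moreover have "(\<integral>u. p u * q u y * w y \<partial>M) = (\<integral>u. p u * q u y \<partial>M) * w y" for y
    by simp
  ultimately show ?thesis by simp
qed

end

context qve
begin

text \<open>Schur test: \<^term>\<open>Im (m z x)\<close> is a positive supersolution of the kernel
  \<open>\<bar>m\<bar>\<^sup>2 S\<close>, so the quadratic form of \<open>S\<close> is dominated by multiplication with \<open>\<bar>m\<bar>\<^sup>-\<^sup>2\<close>.\<close>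

lemma S_quadratic_form_le:
  fixes G :: "'a \<Rightarrow> real"
  assumes z: "0 < Im z"
    and G [measurable]: "G \<in> borel_measurable M" and G_bdd: "\<And>x. x \<in> space M \<Longrightarrow> \<bar>G x\<bar> \<le> C"
  shows "(\<integral>x. G x * (\<integral>y. s x y * G y \<partial>M) \<partial>M) \<le> (\<integral>x. (G x)\<^sup>2 / (cmod (m z x))\<^sup>2 \<partial>M)"
proof -
  note [measurable] = m_meas[OF z]
  define h where "h x = Im (m z x)" for x
  have [measurable]: "h \<in> borel_measurable M" unfolding h_def by measurable
  obtain b where b: "0 < b" "\<And>x. x \<in> space M \<Longrightarrow> b \<le> h x"
    using Im_m_pos_lower[OF z] unfolding h_def by metis
  obtain d where d: "0 < d" "\<And>x. x \<in> space M \<Longrightarrow> d \<le> cmod (m z x)"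
    using cmod_m_pos_lower[OF z] by metis
  obtain H where H: "\<And>x. x \<in> space M \<Longrightarrow> \<bar>h x\<bar> \<le> H"
    using Im_bdd[OF z] unfolding h_def by metis
  obtain B where B: "0 < B" "\<And>x y. x \<in> space M \<Longrightarrow> y \<in> space M \<Longrightarrow> s x y \<le> B"
    by (rule s_bound) blast
  have hpos: "0 < h x" if "x \<in> space M" for x using b that by fastforce
  obtain x0 where "x0 \<in> space M" using not_empty by blast
  then have nn: "0 \<le> C" "0 \<le> H" using G_bdd H by (meson abs_ge_zero order_trans)+
  \<comment> \<open>\<open>k\<close> is the weight produced by Young's inequality \<open>2 * (G x *
    G y) \<le> h y * ((G x)\<^sup>2 / h x) + h x * ((G y)\<^sup>2 / h y)\<close>, scaled by
    \<open>s x y\<close>: its row integral contains \<open>S h\<close>, which the supersolution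
    property bounds.\<close>
  define k where "k x y = s x y * (h y * ((G x)\<^sup>2 / h x))" for x y
  have k_meas [measurable]: "(\<lambda>(x, y). k x y) \<in> borel_measurable (M \<Otimes>\<^sub>M M)"
    unfolding k_def by measurable
  have G2: "(G x)\<^sup>2 \<le> C\<^sup>2" if "x \<in> space M" for x
    using G_bdd[OF that] by (simp add: abs_le_square_iff[symmetric])
  have k_bdd: "\<bar>k x y\<bar> \<le> B * (H * (C\<^sup>2 / b))" if "x \<in> space M" "y \<in> space M" for x y
    unfolding k_def abs_mult abs_divide
    using that B H[of y] s_nonneg[of x y] b nn hpos[of x] G2[of x]
    by (intro mult_mono frac_le) (auto simp: less_imp_le)
  define q where "q x y = G x * (s x y * G y)" for x y
  have q_meas [measurable]: "(\<lambda>(x, y). q x y) \<in> borel_measurable (M \<Otimes>\<^sub>M M)"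
    unfolding q_def by measurable
  have q_bdd: "\<bar>q x y\<bar> \<le> C * (B * C)" if "x \<in> space M" "y \<in> space M" for x y
    unfolding q_def abs_mult
    using that B s_nonneg[of x y] nn G_bdd by (intro mult_mono) auto
  have q_le: "q x y \<le> (k x y + k y x) / 2" if xy: "x \<in> space M" "y \<in> space M" for x y
  proof -
    \<comment> \<open>Young's inequality is this expanded square.\<close>
    have "0 \<le> (G x * h y - G y * h x)\<^sup>2 / (h x * h y)"
      using hpos xy by (intro divide_nonneg_pos) auto
    also have "\<dots> = h y * ((G x)\<^sup>2 / h x) + h x * ((G y)\<^sup>2 / h y) - 2 * (G x * G y)"
      using hpos[OF xy(1)] hpos[OF xy(2)] by (simp add: power2_eq_square field_simps)
    finally have "s x y * (2 * (G x * G y)) \<le> s x y * (h y * ((G x)\<^sup>2 / h x) + h x * ((G y)\<^sup>2 / h y))"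
      using s_nonneg xy by (intro mult_left_mono) auto
    then show ?thesis
      unfolding q_def k_def using s_sym[OF xy] by (simp add: algebra_simps)
  qed
  define k' where "k' x y = k y x" for x y
  have k'_meas [measurable]: "(\<lambda>(x, y). k' x y) \<in> borel_measurable (M \<Otimes>\<^sub>M M)"
    unfolding k'_def by measurable
  have k'_bdd: "\<bar>k' x y\<bar> \<le> B * (H * (C\<^sup>2 / b))" if "x \<in> space M" "y \<in> space M" for x y
    using k_bdd that unfolding k'_def by auto
  note ri = kernel_row_integrable[OF q_meas q_bdd]
    kernel_row_integrable[OF k_meas k_bdd] kernel_row_integrable[OF k'_meas k'_bdd]
  have ii: "integrable M (\<lambda>x. \<integral>y. q x y \<partial>M)" "integrable M (\<lambda>x. \<integral>y. k x y \<partial>M)"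
    "integrable M (\<lambda>x. \<integral>y. k' x y \<partial>M)"
    using kernel_integral_bdd[OF q_meas q_bdd]
      kernel_integral_bdd[OF k_meas k_bdd] kernel_integral_bdd[OF k'_meas k'_bdd]
    by (auto intro!: integrable_bounded)
  have "(\<integral>x. G x * (\<integral>y. s x y * G y \<partial>M) \<partial>M) = (\<integral>x. \<integral>y. q x y \<partial>M \<partial>M)"
    by (simp add: q_def)
  also have "\<dots> \<le> (\<integral>x. ((\<integral>y. k x y \<partial>M) + (\<integral>y. k' x y \<partial>M)) / 2 \<partial>M)"
  proof (intro integral_mono ii integrable_divide Bochner_Integration.integrable_add)
    fix x assume x: "x \<in> space M"
    have "(\<integral>y. q x y \<partial>M) \<le> (\<integral>y. (k x y + k' x y) / 2 \<partial>M)"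
      using q_le[OF x]
      by (intro integral_mono ri integrable_divide Bochner_Integration.integrable_add x)
        (auto simp: k'_def)
    then show "(\<integral>y. q x y \<partial>M) \<le> ((\<integral>y. k x y \<partial>M) + (\<integral>y. k' x y \<partial>M)) / 2"
      using ri x by simp
  qed
  also have "\<dots> = ((\<integral>x. \<integral>y. k x y \<partial>M \<partial>M) + (\<integral>x. \<integral>y. k' x y \<partial>M \<partial>M)) / 2"
    using ii by simp
  \<comment> \<open>\<open>k'\<close> is the transpose of \<open>k\<close>, so both halves of the
    symmetrised majorant have the same double integral.\<close>
  also have "(\<integral>x. \<integral>y. k' x y \<partial>M \<partial>M) = (\<integral>x. \<integral>y. k x y \<partial>M \<partial>M)"
    by (subst kernel_Fubini[OF k'_meas k'_bdd]) (auto simp: k'_def)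
  also have "((\<integral>x. \<integral>y. k x y \<partial>M \<partial>M) + (\<integral>x. \<integral>y. k x y \<partial>M \<partial>M)) / 2 = (\<integral>x. \<integral>y. k x y \<partial>M \<partial>M)"
    by simp
  also have "\<dots> \<le> (\<integral>x. (G x)\<^sup>2 / (cmod (m z x))\<^sup>2 \<partial>M)"
  proof (intro integral_mono ii integrable_bounded)
    fix x assume x: "x \<in> space M"
    show "norm ((G x)\<^sup>2 / (cmod (m z x))\<^sup>2) \<le> C\<^sup>2 / d\<^sup>2"
      using G2[OF x] d(2)[OF x] d(1) by (simp add: frac_le power_mono)
    \<comment> \<open>The row integral is \<open>S h\<close> times
      \<open>(G x)\<^sup>2 / h x\<close>; after \<open>S_Im_le\<close> the factor \<open>h x\<close>
      cancels.\<close>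
    have "(\<integral>y. k x y \<partial>M) = (\<integral>y. s x y * h y \<partial>M) * ((G x)\<^sup>2 / h x)"
      unfolding k_def by (simp add: mult.assoc[symmetric])
    also have "\<dots> \<le> (h x / (cmod (m z x))\<^sup>2) * ((G x)\<^sup>2 / h x)"
      using S_Im_le[OF z x] m_nonzero[OF z x] hpos[OF x] unfolding h_def
      by (intro mult_right_mono) (auto simp: field_simps)
    also have "\<dots> = (G x)\<^sup>2 / (cmod (m z x))\<^sup>2"
      using hpos[OF x] by simp
    finally show "(\<integral>y. k x y \<partial>M) \<le> (G x)\<^sup>2 / (cmod (m z x))\<^sup>2" .
  qed measurable
  finally show ?thesis .
qed

text \<open>Test the quadratic form with \<open>G = \<bar>m\<bar>\<^sup>2 \<rho>\<close>, where
  \<open>\<rho>\<close> collects the row integrals of \<open>r\<close>. The right side of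
  \<open>S_quadratic_form_le\<close> is then \<open>Y\<close>, the integral of
  \<open>\<bar>m\<bar>\<^sup>2 \<rho>\<^sup>2\<close>. By (A) the left side dominates the squared L2
  norm of \<open>r G\<close>, hence the square of its mean, and that mean is again \<open>Y\<close>.
  So \<open>Y\<^sup>2 \<le> Y\<close>, and \<open>\<rho> \<ge> \<delta>\<close> gives the
  claim.\<close>

lemma m_L2_bound:
  assumes z: "0 < Im z"
    and r: "sym_kernel M r"
    and rr: "\<And>x y. x \<in> space M \<Longrightarrow> y \<in> space M \<Longrightarrow> (\<integral>u. r x u * r u y \<partial>M) \<le> s x y"
    and \<delta>: "0 < \<delta>" "\<And>x. x \<in> space M \<Longrightarrow> \<delta> \<le> (\<integral>y. r x y \<partial>M)"
  shows "(\<integral>x. (cmod (m z x))\<^sup>2 \<partial>M) \<le> 1 / \<delta>\<^sup>2"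
proof -
  note [measurable] = m_meas[OF z]
  have r_meas [measurable]: "(\<lambda>(x, y). r x y) \<in> borel_measurable (M \<Otimes>\<^sub>M M)"
    using r by (simp add: sym_kernel_def)
  have r_nonneg: "0 \<le> r x y" and r_sym: "r x y = r y x" if "x \<in> space M" "y \<in> space M" for x y
    using r that by (auto simp: sym_kernel_def)
  obtain R where R: "\<And>x y. x \<in> space M \<Longrightarrow> y \<in> space M \<Longrightarrow> r x y \<le> R"
    using r unfolding sym_kernel_def by blast
  have R': "\<bar>r x y\<bar> \<le> R" if "x \<in> space M" "y \<in> space M" for x y
    using R r_nonneg that by auto
  obtain x0 where x0: "x0 \<in> space M" using not_empty by blast
  then have "0 \<le> R" using R' by (meson abs_ge_zero order_trans)
  define \<rho> where "\<rho> x = (\<integral>y. r x y \<partial>M)" for x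
  have [measurable]: "\<rho> \<in> borel_measurable M" unfolding \<rho>_def by measurable
  have \<rho>_bdd: "\<bar>\<rho> x\<bar> \<le> R" if "x \<in> space M" for x
    unfolding \<rho>_def by (rule kernel_integral_bdd[OF r_meas R' that])
  have \<rho>_ge: "\<delta> \<le> \<rho> x" if "x \<in> space M" for x using \<delta>(2)[OF that] by (simp add: \<rho>_def)
  \<comment> \<open>\<open>E\<close> only secures integrability; the final bound is free of
    it.\<close>
  define E where "E = 1 / Im z"
  have E: "0 < E" "\<And>x. x \<in> space M \<Longrightarrow> cmod (m z x) \<le> E"
    using z cmod_m_le[OF z] by (auto simp: E_def)
  define G where "G x = (cmod (m z x))\<^sup>2 * \<rho> x" for x
  have G_meas [measurable]: "G \<in> borel_measurable M" unfolding G_def by measurable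
  have E2: "(cmod (m z x))\<^sup>2 \<le> E\<^sup>2" if "x \<in> space M" for x
    using E that by (intro power_mono) auto
  have G_bdd: "\<bar>G x\<bar> \<le> E\<^sup>2 * R" if "x \<in> space M" for x
    unfolding G_def abs_mult using E2 \<rho>_bdd that by (intro mult_mono) auto
  have G_nonneg: "0 \<le> G x" if "x \<in> space M" for x
    using \<rho>_ge[OF that] \<delta> by (auto simp: G_def)
  have "0 \<le> E\<^sup>2 * R" using G_bdd[OF x0] by linarith
  define g where "g u = (\<integral>y. r u y * G y \<partial>M)" for u
  have [measurable]: "g \<in> borel_measurable M" unfolding g_def by measurable
  have rG_meas: "(\<lambda>(x, y). r x y * G y) \<in> borel_measurable (M \<Otimes>\<^sub>M M)" by measurable
  have rG_bdd: "\<bar>r x y * G y\<bar> \<le> R * (E\<^sup>2 * R)" if "x \<in> space M" "y \<in> space M" for x y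
    unfolding abs_mult using R' G_bdd that \<open>0 \<le> R\<close> by (intro mult_mono) auto
  have g_bdd: "\<bar>g u\<bar> \<le> R * (E\<^sup>2 * R)" if "u \<in> space M" for u
    unfolding g_def by (rule kernel_integral_bdd[OF rG_meas rG_bdd that])
  have "0 \<le> R * (E\<^sup>2 * R)" using g_bdd[OF x0] by linarith
  define Y where "Y = (\<integral>x. (cmod (m z x))\<^sup>2 * (\<rho> x)\<^sup>2 \<partial>M)"
  have int_g: "integrable M g" using g_bdd by (intro integrable_bounded) auto
  have int_g2: "integrable M (\<lambda>u. (g u)\<^sup>2)"
  proof (rule integrable_bounded)
    show "norm ((g u)\<^sup>2) \<le> (R * (E\<^sup>2 * R))\<^sup>2" if "u \<in> space M" for u
      using g_bdd[OF that] by (simp add: abs_le_square_iff[symmetric])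
  qed measurable
  have "Y = (\<integral>x. \<rho> x * G x \<partial>M)"
    by (simp add: Y_def G_def power2_eq_square algebra_simps)
  also have "\<dots> = (\<integral>x. (\<integral>u. 1 * r u x \<partial>M) * G x \<partial>M)"
    unfolding \<rho>_def using r_sym by (intro Bochner_Integration.integral_cong refl arg_cong2[where f="(*)"]) auto
  \<comment> \<open>The factor 1 fits the row integrals into \<open>kernel_comp_apply\<close> and
    prepares Cauchy-Schwarz against the constant function, whose square has mean 1.\<close>
  also have "\<dots> = (\<integral>u. 1 * g u \<partial>M)"
    unfolding g_def using R' G_bdd by (intro kernel_comp_apply) auto
  finally have Y: "Y = (\<integral>u. 1 * g u \<partial>M)" .
  have "Y\<^sup>2 \<le> (\<integral>u. 1\<^sup>2 \<partial>M) * (\<integral>u. (g u)\<^sup>2 \<partial>M)"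
    unfolding Y using int_g int_g2 by (intro expectation_Cauchy_Schwarz) auto
  also have "\<dots> = (\<integral>u. g u * (\<integral>x. r u x * G x \<partial>M) \<partial>M)"
    by (simp add: prob_space power2_eq_square g_def)
  also have "\<dots> = (\<integral>x. (\<integral>u. g u * r u x \<partial>M) * G x \<partial>M)"
    using R' G_bdd g_bdd by (intro kernel_comp_apply[symmetric]) auto
  also have "\<dots> \<le> (\<integral>x. G x * (\<integral>y. s x y * G y \<partial>M) \<partial>M)"
  proof (rule integral_mono)
    obtain B where B: "0 < B" "\<And>x y. x \<in> space M \<Longrightarrow> y \<in> space M \<Longrightarrow> s x y \<le> B"
      by (rule s_bound) blast
    have 1: "\<bar>\<integral>y. s x y * G y \<partial>M\<bar> \<le> B * (E\<^sup>2 * R)" if "x \<in> space M" for x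
      using that
    proof (rule kernel_integral_bdd[rotated -1])
      show "\<bar>s x y * G y\<bar> \<le> B * (E\<^sup>2 * R)" if "x \<in> space M" "y \<in> space M" for x y
        unfolding abs_mult using B G_bdd s_nonneg that by (intro mult_mono) auto
    qed measurable
    show "integrable M (\<lambda>x. G x * (\<integral>y. s x y * G y \<partial>M))"
    proof (rule integrable_bounded)
      show "norm (G x * (\<integral>y. s x y * G y \<partial>M)) \<le> (E\<^sup>2 * R) * (B * (E\<^sup>2 * R))" if "x \<in> space M" for x
        unfolding real_norm_def abs_mult
        using 1 that G_bdd \<open>0 \<le> E\<^sup>2 * R\<close> by (intro mult_mono) auto
    qed measurable
    have 2: "\<bar>\<integral>u. g u * r u x \<partial>M\<bar> \<le> (R * (E\<^sup>2 * R)) * R" if "x \<in> space M" for x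
      using that
    proof (rule kernel_integral_bdd[rotated -1])
      show "\<bar>g u * r u x\<bar> \<le> (R * (E\<^sup>2 * R)) * R" if "x \<in> space M" "u \<in> space M" for x u
        unfolding abs_mult using R' g_bdd \<open>0 \<le> R * (E\<^sup>2 * R)\<close> that by (intro mult_mono) auto
    qed measurable
    show "integrable M (\<lambda>x. (\<integral>u. g u * r u x \<partial>M) * G x)"
    proof (rule integrable_bounded)
      show "norm ((\<integral>u. g u * r u x \<partial>M) * G x) \<le> ((R * (E\<^sup>2 * R)) * R) * (E\<^sup>2 * R)"
        if "x \<in> space M" for x
        unfolding real_norm_def abs_mult
        using 2 that G_bdd \<open>0 \<le> R * (E\<^sup>2 * R)\<close> \<open>0 \<le> R\<close> by (intro mult_mono) auto
    qed measurable
    fix x assume x: "x \<in> space M"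
    \<comment> \<open>By symmetry of \<open>r\<close> this is the square of \<open>r\<close> applied
      to \<open>G\<close>; as \<open>G\<close> is nonnegative, (A) replaces that square by
      \<open>s\<close>.\<close>
    have "(\<integral>u. g u * r u x \<partial>M) = (\<integral>u. r x u * (\<integral>y. r u y * G y \<partial>M) \<partial>M)"
      unfolding g_def using r_sym[OF x]
      by (intro Bochner_Integration.integral_cong refl) (simp add: mult.commute)
    also have "\<dots> = (\<integral>y. (\<integral>u. r x u * r u y \<partial>M) * G y \<partial>M)"
      using R' G_bdd x by (intro kernel_comp_apply[symmetric]) auto
    also have "\<dots> \<le> (\<integral>y. s x y * G y \<partial>M)"
    proof (intro integral_mono integrable_s_mult[OF x _ G_bdd] mult_right_mono rr x G_nonneg)
      have "\<bar>\<integral>u. r x u * r u y \<partial>M\<bar> \<le> R * R" if "y \<in> space M" for y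
        using that
      proof (rule kernel_integral_bdd[rotated -1])
        show "\<bar>r x u * r u y\<bar> \<le> R * R" if "y \<in> space M" "u \<in> space M" for y u
          unfolding abs_mult using R' x \<open>0 \<le> R\<close> that by (intro mult_mono) auto
        show "(\<lambda>(y, u). r x u * r u y) \<in> borel_measurable (M \<Otimes>\<^sub>M M)" using x by measurable
      qed
      then have "norm ((\<integral>u. r x u * r u y \<partial>M) * G y) \<le> (R * R) * (E\<^sup>2 * R)" if "y \<in> space M" for y
        unfolding real_norm_def abs_mult
        using that G_bdd \<open>0 \<le> R\<close> by (intro mult_mono) auto
      then show "integrable M (\<lambda>y. (\<integral>u. r x u * r u y \<partial>M) * G y)"
        using x by (intro integrable_bounded) measurable
    qed measurable
    finally show "(\<integral>u. g u * r u x \<partial>M) * G x \<le> G x * (\<integral>y. s x y * G y \<partial>M)"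
      using G_nonneg[OF x] by (simp add: mult.commute mult_left_mono)
  qed
  also have "\<dots> \<le> (\<integral>x. (G x)\<^sup>2 / (cmod (m z x))\<^sup>2 \<partial>M)"
    by (rule S_quadratic_form_le[OF z G_meas G_bdd])
  also have "\<dots> = Y"
    unfolding Y_def G_def using m_nonzero[OF z]
    by (intro Bochner_Integration.integral_cong refl) (simp add: power2_eq_square)
  \<comment> \<open>The chain reads \<open>Y\<^sup>2 \<le> Y\<close>, which excludes
    \<open>Y > 1\<close>.\<close>
  finally have "Y \<le> 1"
    by (metis linorder_not_less mult_less_cancel_right2 not_one_le_zero power2_eq_square zero_le_one
      mult_le_cancel_right2 less_le_trans zero_less_one)
  have "\<delta>\<^sup>2 * (\<integral>x. (cmod (m z x))\<^sup>2 \<partial>M) = (\<integral>x. \<delta>\<^sup>2 * (cmod (m z x))\<^sup>2 \<partial>M)" by simp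
  also have "\<dots> \<le> Y"
    unfolding Y_def
  proof (rule integral_mono)
    show "integrable M (\<lambda>x. \<delta>\<^sup>2 * (cmod (m z x))\<^sup>2)"
      using E2 by (intro integrable_mult_right integrable_bounded[of _ "E\<^sup>2"]) auto
    show "integrable M (\<lambda>x. (cmod (m z x))\<^sup>2 * (\<rho> x)\<^sup>2)"
    proof (rule integrable_bounded)
      show "norm ((cmod (m z x))\<^sup>2 * (\<rho> x)\<^sup>2) \<le> E\<^sup>2 * R\<^sup>2" if "x \<in> space M" for x
        using E2[OF that] \<rho>_bdd[OF that]
        by (auto simp: abs_le_square_iff[symmetric] intro!: mult_mono)
    qed measurable
    show "\<delta>\<^sup>2 * (cmod (m z x))\<^sup>2 \<le> (cmod (m z x))\<^sup>2 * (\<rho> x)\<^sup>2" if "x \<in> space M" for x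
      using \<rho>_ge[OF that] \<delta>(1)
      by (subst mult.commute) (intro mult_left_mono power_mono, auto)
  qed
  finally show ?thesis using \<open>Y \<le> 1\<close> \<delta>(1) by (simp add: field_simps)
qed

end

section \<open>The uniform bound and the iterated kernel\<close>

context qve
begin

lemma row_diff_bound:
  obtains B where "0 < B" "\<And>x y u. x \<in> space M \<Longrightarrow> y \<in> space M \<Longrightarrow> u \<in> space M \<Longrightarrow> \<bar>s x u - s y u\<bar> \<le> B"
proof -
  obtain B where B: "0 < B" "\<And>x y. x \<in> space M \<Longrightarrow> y \<in> space M \<Longrightarrow> s x y \<le> B"
    by (rule s_bound) blast
  have "\<bar>s x u - s y u\<bar> \<le> B" if "x \<in> space M" "y \<in> space M" "u \<in> space M" for x y u
    using B(2)[of x u] B(2)[of y u] s_nonneg[of x u] s_nonneg[of y u] that by auto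
  then show thesis using that B(1) by blast
qed

text \<open>Subtracting the equation at two points cancels \<open>z\<close>, so this comparison does
  not deteriorate as \<open>Im z\<close> tends to 0.\<close>

lemma inverse_diff_le:
  assumes z: "0 < Im z" and xy: "x \<in> space M" "y \<in> space M"
  shows "cmod (1 / m z x - 1 / m z y) \<le> \<bar>a x - a y\<bar> + (\<integral>u. \<bar>s x u - s y u\<bar> * cmod (m z u) \<partial>M)"
proof -
  have "1 / m z x - 1 / m z y = (- 1 / m z y) - (- 1 / m z x)" by simp
  also have "\<dots> = of_real (a y - a x)
      + ((\<integral>u. of_real (s y u) * m z u \<partial>M) - (\<integral>u. of_real (s x u) * m z u \<partial>M))"
    unfolding QVE[OF z xy(1)] QVE[OF z xy(2)] by simp
  also have "(\<integral>u. of_real (s y u) * m z u \<partial>M) - (\<integral>u. of_real (s x u) * m z u \<partial>M)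
      = (\<integral>u. of_real (s y u) * m z u - of_real (s x u) * m z u \<partial>M)"
    using integrable_s_m[OF z xy(1)] integrable_s_m[OF z xy(2)] by simp
  finally have "cmod (1 / m z x - 1 / m z y) \<le> cmod (of_real (a y - a x))
      + cmod (\<integral>u. of_real (s y u) * m z u - of_real (s x u) * m z u \<partial>M)"
    by (metis norm_triangle_ineq)
  also have "cmod (of_real (a y - a x)) = \<bar>a x - a y\<bar>"
    by (simp only: norm_of_real abs_minus_commute)
  also have "cmod (\<integral>u. of_real (s y u) * m z u - of_real (s x u) * m z u \<partial>M)
      \<le> (\<integral>u. cmod (of_real (s y u) * m z u - of_real (s x u) * m z u) \<partial>M)"
    by (rule integral_norm_bound)
  also have "\<dots> = (\<integral>u. \<bar>s x u - s y u\<bar> * cmod (m z u) \<partial>M)"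
  proof (intro Bochner_Integration.integral_cong refl)
    fix u
    have "complex_of_real (s y u) * m z u - of_real (s x u) * m z u = of_real (s y u - s x u) * m z u"
      by (simp add: left_diff_distrib)
    then show "cmod (of_real (s y u) * m z u - of_real (s x u) * m z u) = \<bar>s x u - s y u\<bar> * cmod (m z u)"
      by (simp only: norm_mult norm_of_real abs_minus_commute)
  qed
  finally show ?thesis by simp
qed

text \<open>Put \<open>\<epsilon> = 1 / \<bar>m\<^sub>x\<bar>\<^sup>2\<close>. By
  \<open>inverse_diff_le\<close>, Cauchy-Schwarz and the L2 bound, the integrand in (C) is at most
  \<open>3 * N * \<bar>m\<^sub>y\<bar>\<^sup>2\<close>; integrating over \<open>y\<close> bounds the
  integral by \<open>3 * N * N\<close>. Hence (C) keeps \<open>\<epsilon>\<close> away from 0, and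
  the threshold depends on neither \<open>x\<close> nor \<open>z\<close>.\<close>

lemma m_sup_bound:
  assumes A: "\<exists>r. sym_kernel M r
              \<and> (\<forall>x\<in>space M. \<forall>y\<in>space M. (\<integral>u. r x u * r u y \<partial>M) \<le> s x y)
              \<and> (\<exists>\<delta>>0. \<forall>x\<in>space M. \<delta> \<le> (\<integral>y. r x y \<partial>M))"
    and C: "\<forall>B::real. \<exists>\<epsilon>\<^sub>0>0. \<forall>\<epsilon>. 0 < \<epsilon> \<and> \<epsilon> < \<epsilon>\<^sub>0 \<longrightarrow> (\<forall>x\<in>space M.
              B \<le> (\<integral>y. 1 / (\<epsilon> + (a x - a y)\<^sup>2 + (\<integral>u. (s x u - s y u)\<^sup>2 \<partial>M)) \<partial>M))"
  obtains L where "0 < L" "\<And>z x. 0 < Im z \<Longrightarrow> x \<in> space M \<Longrightarrow> cmod (m z x) \<le> L"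
proof -
  obtain r \<delta> where r: "sym_kernel M r"
    "\<And>x y. x \<in> space M \<Longrightarrow> y \<in> space M \<Longrightarrow> (\<integral>u. r x u * r u y \<partial>M) \<le> s x y"
    and \<delta>: "0 < \<delta>" "\<And>x. x \<in> space M \<Longrightarrow> \<delta> \<le> (\<integral>y. r x y \<partial>M)"
    using A by blast
  \<comment> \<open>\<open>N \<ge> 1\<close> lets one factor \<open>N\<close> dominate all three
    terms of the denominator below.\<close>
  define N where "N = max 1 (1 / \<delta>\<^sup>2)"
  have N: "1 \<le> N" "(\<integral>x. (cmod (m z x))\<^sup>2 \<partial>M) \<le> N" if "0 < Im z" for z
    using m_L2_bound[OF that r \<delta>] by (auto simp: N_def)
  have "1 \<le> N" by (simp add: N_def)
  \<comment> \<open>The level \<open>3 * N * N + 1\<close> exceeds the bound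
    \<open>3 * N * N\<close> by one, which gives the contradiction.\<close>
  obtain \<epsilon>\<^sub>0 where \<epsilon>\<^sub>0: "0 < \<epsilon>\<^sub>0" and large: "\<And>\<epsilon> x. 0 < \<epsilon> \<Longrightarrow> \<epsilon> < \<epsilon>\<^sub>0 \<Longrightarrow> x \<in> space M \<Longrightarrow>
      3 * N * N + 1 \<le> (\<integral>y. 1 / (\<epsilon> + (a x - a y)\<^sup>2 + (\<integral>u. (s x u - s y u)\<^sup>2 \<partial>M)) \<partial>M)"
    using C[rule_format, of "3 * N * N + 1"] by blast
  obtain B where B: "0 < B" "\<And>x y u. x \<in> space M \<Longrightarrow> y \<in> space M \<Longrightarrow> u \<in> space M \<Longrightarrow> \<bar>s x u - s y u\<bar> \<le> B"
    by (rule row_diff_bound) blast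
  have "cmod (m z x) \<le> 1 / sqrt \<epsilon>\<^sub>0" if z: "0 < Im z" and x: "x \<in> space M" for z x
  proof -
    note [measurable] = m_meas[OF z]
    define \<epsilon> where "\<epsilon> = 1 / (cmod (m z x))\<^sup>2"
    have mx: "0 < cmod (m z x)" using m_nonzero[OF z x] by simp
    then have \<epsilon>: "0 < \<epsilon>" by (simp add: \<epsilon>_def)
    define E where "E = 1 / Im z"
    have E: "0 < E" "\<And>x. x \<in> space M \<Longrightarrow> cmod (m z x) \<le> E"
      using z cmod_m_le[OF z] by (auto simp: E_def)
    define D where "D y = (\<integral>u. (s x u - s y u)\<^sup>2 \<partial>M)" for y
    have [measurable]: "D \<in> borel_measurable M" unfolding D_def using x by measurable
    have D_nonneg: "0 \<le> D y" for y by (simp add: D_def)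
    have int_m2: "integrable M (\<lambda>u. (cmod (m z u))\<^sup>2)"
      using E by (intro integrable_bounded[of _ "E\<^sup>2"]) (auto intro!: power_mono)
    have le: "1 / (\<epsilon> + (a x - a y)\<^sup>2 + D y) \<le> 3 * N * (cmod (m z y))\<^sup>2" if y: "y \<in> space M" for y
    proof -
      define P where "P = (\<integral>u. \<bar>s x u - s y u\<bar> * cmod (m z u) \<partial>M)"
      have "P\<^sup>2 \<le> (\<integral>u. \<bar>s x u - s y u\<bar>\<^sup>2 \<partial>M) * (\<integral>u. (cmod (m z u))\<^sup>2 \<partial>M)"
        unfolding P_def
      proof (intro expectation_Cauchy_Schwarz int_m2)
        show "integrable M (\<lambda>u. \<bar>s x u - s y u\<bar>\<^sup>2)"
          using B(2)[OF x y] x y B(1)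
          by (intro integrable_bounded[of _ "B\<^sup>2"]) (auto simp: abs_le_square_iff[symmetric])
        show "integrable M (\<lambda>u. \<bar>s x u - s y u\<bar> * cmod (m z u))"
          using B(2)[OF x y] x y E B(1)
          by (intro integrable_bounded[of _ "B * E"]) (auto simp: abs_mult intro!: mult_mono)
      qed
      also have "\<dots> \<le> D y * N"
        using N(2)[OF z] D_nonneg[of y] by (auto simp: D_def intro!: mult_left_mono)
      finally have P2: "P\<^sup>2 \<le> D y * N" .
      have my: "0 < cmod (m z y)" using m_nonzero[OF z y] by simp
      have "1 / cmod (m z y) = cmod (1 / m z y)" by (simp add: norm_divide)
      also have "\<dots> \<le> cmod (1 / m z x) + cmod (1 / m z x - 1 / m z y)"
        by (metis norm_triangle_sub norm_minus_commute)
      also have "cmod (1 / m z x - 1 / m z y) \<le> \<bar>a x - a y\<bar> + P"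
        unfolding P_def by (rule inverse_diff_le[OF z x y])
      finally have "(1 / cmod (m z y))\<^sup>2 \<le> (1 / cmod (m z x) + \<bar>a x - a y\<bar> + P)\<^sup>2"
        using my by (intro power_mono) (auto simp: norm_divide)
      also have "\<dots> \<le> 3 * ((1 / cmod (m z x))\<^sup>2 + \<bar>a x - a y\<bar>\<^sup>2 + P\<^sup>2)"
      proof -
        have "(p + q + w)\<^sup>2 \<le> 3 * (p\<^sup>2 + q\<^sup>2 + w\<^sup>2)" for p q w :: real
          using zero_le_power2[of "p - q"] zero_le_power2[of "p - w"] zero_le_power2[of "q - w"]
          by (simp add: power2_eq_square algebra_simps)
        then show ?thesis by blast
      qed
      also have "\<dots> \<le> 3 * (\<epsilon> + (a x - a y)\<^sup>2 + D y * N)"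
        using P2 by (simp add: \<epsilon>_def power_divide)
      also have "\<dots> \<le> 3 * (N * \<epsilon> + N * (a x - a y)\<^sup>2 + N * D y)"
        using mult_right_mono[OF \<open>1 \<le> N\<close> less_imp_le[OF \<epsilon>]]
          mult_right_mono[OF \<open>1 \<le> N\<close> zero_le_power2[of "a x - a y"]]
        by (simp add: mult.commute)
      also have "\<dots> = 3 * N * (\<epsilon> + (a x - a y)\<^sup>2 + D y)" by (simp add: algebra_simps)
      finally have "1 / (cmod (m z y))\<^sup>2 \<le> 3 * N * (\<epsilon> + (a x - a y)\<^sup>2 + D y)"
        by (simp add: power_divide)
      moreover have "0 < \<epsilon> + (a x - a y)\<^sup>2 + D y" using \<epsilon> D_nonneg[of y] by (simp add: add_pos_nonneg)
      ultimately show ?thesis using my by (simp add: field_simps)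
    qed
    have "\<epsilon>\<^sub>0 \<le> \<epsilon>"
    proof (rule ccontr)
      assume "\<not> \<epsilon>\<^sub>0 \<le> \<epsilon>"
      then have "3 * N * N + 1 \<le> (\<integral>y. 1 / (\<epsilon> + (a x - a y)\<^sup>2 + D y) \<partial>M)"
        unfolding D_def using large[OF \<epsilon> _ x] by simp
      also have "\<dots> \<le> (\<integral>y. 3 * N * (cmod (m z y))\<^sup>2 \<partial>M)"
      proof (intro integral_mono integrable_mult_right int_m2 le)
        have "norm (1 / (\<epsilon> + (a x - a y)\<^sup>2 + D y)) \<le> 1 / \<epsilon>" for y
          using \<epsilon> D_nonneg[of y] by (simp add: add_pos_nonneg frac_le)
        then show "integrable M (\<lambda>y. 1 / (\<epsilon> + (a x - a y)\<^sup>2 + D y))"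
          by (intro integrable_bounded[of _ "1 / \<epsilon>"]) auto
      qed auto
      also have "\<dots> = 3 * N * (\<integral>y. (cmod (m z y))\<^sup>2 \<partial>M)" by simp
      also have "\<dots> \<le> 3 * N * N"
        using N(2)[OF z] \<open>1 \<le> N\<close> by (intro mult_left_mono) auto
      finally show False by simp
    qed
    then have "\<epsilon>\<^sub>0 * (cmod (m z x))\<^sup>2 \<le> 1"
      using mx by (simp add: \<epsilon>_def field_simps)
    then have "sqrt \<epsilon>\<^sub>0 * cmod (m z x) \<le> 1"
      using real_sqrt_le_mono[of "\<epsilon>\<^sub>0 * (cmod (m z x))\<^sup>2" 1] by (simp add: real_sqrt_mult)
    then show ?thesis using \<epsilon>\<^sub>0 by (simp add: field_simps)
  qed
  then show thesis using that[of "1 / sqrt \<epsilon>\<^sub>0"] \<epsilon>\<^sub>0 by simp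
qed

section \<open>Iterated kernels and supersolutions\<close>

lemma kernel_pow_meas_bdd:
  "(\<lambda>(x, y). kernel_pow_Suc M s n x y) \<in> borel_measurable (M \<Otimes>\<^sub>M M) \<and>
   (\<exists>C. \<forall>x\<in>space M. \<forall>y\<in>space M. \<bar>kernel_pow_Suc M s n x y\<bar> \<le> C)"
proof (induction n)
  case 0
  obtain B where "\<And>x y. x \<in> space M \<Longrightarrow> y \<in> space M \<Longrightarrow> s x y \<le> B"
    by (rule s_bound) blast
  then show ?case using s_nonneg s_pair by (auto intro!: exI[of _ B])
next
  case (Suc n)
  then have [measurable]: "(\<lambda>(x, y). kernel_pow_Suc M s n x y) \<in> borel_measurable (M \<Otimes>\<^sub>M M)" by simp
  obtain C where C: "\<And>x y. x \<in> space M \<Longrightarrow> y \<in> space M \<Longrightarrow> \<bar>kernel_pow_Suc M s n x y\<bar> \<le> C"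
    using Suc by blast
  obtain B where B: "0 < B" "\<And>x y. x \<in> space M \<Longrightarrow> y \<in> space M \<Longrightarrow> s x y \<le> B"
    by (rule s_bound) blast
  obtain x0 where x0: "x0 \<in> space M" using not_empty by blast
  then have "0 \<le> C" using C by (meson abs_ge_zero order_trans)
  have "\<bar>\<integral>u. kernel_pow_Suc M s n x u * s u y \<partial>M\<bar> \<le> C * B" if "x \<in> space M" "y \<in> space M" for x y
    using that(2)
  proof (rule kernel_integral_bdd[rotated -1])
    show "\<bar>kernel_pow_Suc M s n x u * s u y\<bar> \<le> C * B" if "y \<in> space M" "u \<in> space M" for y u
      unfolding abs_mult using C B s_nonneg \<open>0 \<le> C\<close> \<open>x \<in> space M\<close> that by (intro mult_mono) auto
    show "(\<lambda>(y, u). kernel_pow_Suc M s n x u * s u y) \<in> borel_measurable (M \<Otimes>\<^sub>M M)"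
      using that(1) by measurable
  qed
  then show ?case by (auto intro!: exI[of _ "C * B"])
qed

lemma kernel_pow_nonneg:
  "x \<in> space M \<Longrightarrow> y \<in> space M \<Longrightarrow> 0 \<le> kernel_pow_Suc M s n x y"
proof (induction n arbitrary: y)
  case (Suc n)
  then show ?case using s_nonneg by (auto intro!: integral_nonneg_AE)
qed (use s_nonneg in auto)

text \<open>A supersolution for \<open>c S\<close> is one for all powers, because the iterated
  kernels are nonnegative and so preserve inequalities. The exponent is \<open>Suc n\<close> because
  \<open>kernel_pow_Suc M s n\<close> belongs to the power \<open>n + 1\<close> of S.\<close>

lemma kernel_pow_le_iterate:
  assumes h: "h \<in> borel_measurable M" "\<And>x. x \<in> space M \<Longrightarrow> 0 \<le> h x \<and> h x \<le> H"
    and c: "0 < c" and super: "\<And>x. x \<in> space M \<Longrightarrow> c * (\<integral>y. s x y * h y \<partial>M) \<le> h x"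
    and x: "x \<in> space M"
  shows "c ^ Suc n * (\<integral>y. kernel_pow_Suc M s n x y * h y \<partial>M) \<le> h x"
proof (induction n)
  case 0
  then show ?case using super x by simp
next
  case (Suc n)
  note [measurable] = h(1)
  obtain B where B: "0 < B" "\<And>x y. x \<in> space M \<Longrightarrow> y \<in> space M \<Longrightarrow> s x y \<le> B"
    by (rule s_bound) blast
  have [measurable]: "(\<lambda>(x, y). kernel_pow_Suc M s n x y) \<in> borel_measurable (M \<Otimes>\<^sub>M M)"
    using kernel_pow_meas_bdd[of n] by simp
  obtain C where C: "\<And>x y. x \<in> space M \<Longrightarrow> y \<in> space M \<Longrightarrow> \<bar>kernel_pow_Suc M s n x y\<bar> \<le> C"
    using kernel_pow_meas_bdd[of n] by blast
  have "0 \<le> C" "0 \<le> H" using C[OF x x] h(2)[OF x] by linarith+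
  \<comment> \<open>Fubini splits off the last factor of S, so that the hypothesis on
    \<open>c S h\<close> applies inside the integral.\<close>
  have "c ^ Suc (Suc n) * (\<integral>y. kernel_pow_Suc M s (Suc n) x y * h y \<partial>M)
      = c ^ Suc n * (c * (\<integral>u. kernel_pow_Suc M s n x u * (\<integral>y. s u y * h y \<partial>M) \<partial>M))"
    using kernel_comp_apply[OF s_pair, of B "kernel_pow_Suc M s n x" C h H] B C s_nonneg x h by simp
  also have "\<dots> = c ^ Suc n * (\<integral>u. kernel_pow_Suc M s n x u * (c * (\<integral>y. s u y * h y \<partial>M)) \<partial>M)"
    by (simp add: mult.left_commute)
  also have "\<dots> \<le> c ^ Suc n * (\<integral>u. kernel_pow_Suc M s n x u * h u \<partial>M)"
  proof (intro mult_left_mono integral_mono)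
    show "integrable M (\<lambda>u. kernel_pow_Suc M s n x u * h u)"
      using C h x \<open>0 \<le> C\<close> by (intro integrable_bounded[of _ "C * H"]) (auto simp: abs_mult intro!: mult_mono)
    show "integrable M (\<lambda>u. kernel_pow_Suc M s n x u * (c * (\<integral>y. s u y * h y \<partial>M)))"
    proof (rule integrable_bounded)
      show "norm (kernel_pow_Suc M s n x u * (c * (\<integral>y. s u y * h y \<partial>M))) \<le> C * H" if "u \<in> space M" for u
        unfolding real_norm_def abs_mult[of "kernel_pow_Suc M s n x u"]
        using C[OF x that] super[OF that] h(2)[OF that] S_nonneg[OF that, of h] h c \<open>0 \<le> C\<close>
        by (intro mult_mono) auto
    qed (use x in measurable)
  qed (use kernel_pow_nonneg[OF x] super c in \<open>auto intro: mult_left_mono\<close>)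
  also have "\<dots> \<le> h x" by (rule Suc)
  finally show ?case .
qed

end

section \<open>Behaviour near a zero of the density\<close>

text \<open>Heights at most 1 give \<open>\<bar>z\<bar> \<le> \<bar>\<tau>\<bar> + 1\<close>, so
  \<open>b\<close> can be fixed before the height is chosen.\<close>

lemma (in qve) m_lower_bound:
  assumes L: "0 < L" "\<And>z x. 0 < Im z \<Longrightarrow> x \<in> space M \<Longrightarrow> cmod (m z x) \<le> L"
  obtains b where "0 < b"
    "\<And>\<eta> x. 0 < \<eta> \<Longrightarrow> \<eta> \<le> 1 \<Longrightarrow> x \<in> space M \<Longrightarrow> b \<le> cmod (m (Complex \<tau> \<eta>) x)"
proof -
  obtain A where A: "0 < A" "\<And>x. x \<in> space M \<Longrightarrow> \<bar>a x\<bar> \<le> A" by (rule a_bound) blast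
  obtain B where B: "0 < B" "\<And>x y. x \<in> space M \<Longrightarrow> y \<in> space M \<Longrightarrow> s x y \<le> B"
    by (rule s_bound) blast
  define b where "b = 1 / (\<bar>\<tau>\<bar> + 1 + A + B * L)"
  have "0 < b" using A B L by (simp add: b_def add_nonneg_pos add_pos_pos)
  moreover have "b \<le> cmod (m (Complex \<tau> \<eta>) x)" if \<eta>: "0 < \<eta>" "\<eta> \<le> 1" and x: "x \<in> space M" for \<eta> x
  proof -
    have "cmod (Complex \<tau> \<eta>) \<le> \<bar>\<tau>\<bar> + 1"
      using cmod_le[of "Complex \<tau> \<eta>"] \<eta> by simp
    then have "b \<le> 1 / (cmod (Complex \<tau> \<eta>) + A + B * L)"
      unfolding b_def using A B L by (intro divide_left_mono) (auto simp: add_nonneg_pos add_pos_pos)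
    also have "\<dots> \<le> cmod (m (Complex \<tau> \<eta>) x)"
      using B A L(2) \<eta> x by (intro cmod_m_ge) auto
    finally show ?thesis .
  qed
  ultimately show thesis by (rule that)
qed

text \<open>Harnack inequality: by (B) and the iterated supersolution property, \<open>h x0\<close>
  dominates a multiple of the mean of \<open>h\<close>; by \<open>QVE_Im\<close> and
  \<open>S_le\<close>, the mean together with the height dominates \<open>h\<close>
  everywhere.\<close>

lemma (in qve) Im_uniformly_small:
  assumes B: "\<exists>K. \<exists>\<delta>>0. \<forall>x\<in>space M. \<forall>y\<in>space M. \<delta> \<le> kernel_pow_Suc M s K x y"
    and L: "0 < L" "\<And>z x. 0 < Im z \<Longrightarrow> x \<in> space M \<Longrightarrow> cmod (m z x) \<le> L"
    and x0: "x0 \<in> space M"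
    and small: "\<And>\<kappa>. 0 < \<kappa> \<Longrightarrow> \<exists>\<eta>. 0 < \<eta> \<and> \<eta> \<le> \<kappa> \<and> Im (m (Complex \<tau> \<eta>) x0) \<le> \<kappa>"
    and \<epsilon>: "0 < \<epsilon>"
  shows "\<exists>\<eta>>0. \<eta> \<le> 1 \<and> (\<forall>x\<in>space M. Im (m (Complex \<tau> \<eta>) x) \<le> \<epsilon>)"
proof -
  obtain n \<delta> where \<delta>: "0 < \<delta>" "\<And>x y. x \<in> space M \<Longrightarrow> y \<in> space M \<Longrightarrow> \<delta> \<le> kernel_pow_Suc M s n x y"
    using B by blast
  obtain B where B: "0 < B" "\<And>x y. x \<in> space M \<Longrightarrow> y \<in> space M \<Longrightarrow> s x y \<le> B"
    by (rule s_bound) blast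
  obtain b where b: "0 < b"
    "\<And>\<eta> x. 0 < \<eta> \<Longrightarrow> \<eta> \<le> 1 \<Longrightarrow> x \<in> space M \<Longrightarrow> b \<le> cmod (m (Complex \<tau> \<eta>) x)"
    by (rule m_lower_bound[OF L]) blast+
  define c where "c = b\<^sup>2"
  have c: "0 < c" using b by (simp add: c_def)
  define D where "D = c ^ Suc n * \<delta>"
  have D: "0 < D" using c \<delta> by (simp add: D_def)
  \<comment> \<open>\<open>K\<close> is the total loss: if height and \<open>h x0\<close> are at
    most \<open>e\<close>, then \<open>h\<close> is at most
    \<open>L\<^sup>2 * (e + B * (e / D)) = K * e\<close> everywhere. Hence the choice
    \<open>e = \<epsilon> / K\<close> below.\<close>
  define K where "K = L\<^sup>2 * (1 + B / D)"
  have K: "0 < K" using L B D by (simp add: K_def add_pos_pos)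
  obtain \<eta> where \<eta>: "0 < \<eta>" "\<eta> \<le> min (1 :: real) (\<epsilon> / K)" "Im (m (Complex \<tau> \<eta>) x0) \<le> min 1 (\<epsilon> / K)"
    using small[of "min 1 (\<epsilon> / K)"] \<epsilon> K by auto
  define z where "z = Complex \<tau> \<eta>"
  have z: "0 < Im z" using \<eta> by (simp add: z_def)
  note [measurable] = m_meas[OF z]
  define h where "h x = Im (m z x)" for x
  have h_meas [measurable]: "h \<in> borel_measurable M" unfolding h_def by measurable
  have h: "0 \<le> h x \<and> h x \<le> L" if "x \<in> space M" for x
    using m_H[OF z that] L(2)[OF z that] abs_Im_le_cmod[of "m z x"] by (auto simp: h_def)
  have mb: "b \<le> cmod (m z x)" if "x \<in> space M" for x
    unfolding z_def using b(2) \<eta> that by auto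
  have super: "c * (\<integral>y. s x y * h y \<partial>M) \<le> h x" if x: "x \<in> space M" for x
  proof -
    have "c * (\<integral>y. s x y * h y \<partial>M) \<le> (cmod (m z x))\<^sup>2 * (\<integral>y. s x y * h y \<partial>M)"
      unfolding c_def using mb[OF x] b h S_nonneg[OF x, of h] by (intro mult_right_mono power_mono) auto
    also have "\<dots> \<le> h x" using S_Im_le[OF z x] by (simp add: h_def)
    finally show ?thesis .
  qed
  have int_h: "integrable M h" using h by (intro integrable_bounded[of _ L]) auto
  \<comment> \<open>The lower bound \<open>\<delta>\<close> on the iterated kernel turns its action
    on \<open>h\<close> into the mean of \<open>h\<close>.\<close>
  have "D * (\<integral>y. h y \<partial>M) = c ^ Suc n * (\<integral>y. \<delta> * h y \<partial>M)" by (simp add: D_def)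
  also have "\<dots> \<le> c ^ Suc n * (\<integral>y. kernel_pow_Suc M s n x0 y * h y \<partial>M)"
  proof (intro mult_left_mono integral_mono integrable_mult_right int_h)
    have k [measurable]: "(\<lambda>(x, y). kernel_pow_Suc M s n x y) \<in> borel_measurable (M \<Otimes>\<^sub>M M)"
      using kernel_pow_meas_bdd[of n] by simp
    obtain C where C: "\<And>x y. x \<in> space M \<Longrightarrow> y \<in> space M \<Longrightarrow> \<bar>kernel_pow_Suc M s n x y\<bar> \<le> C"
      using kernel_pow_meas_bdd[of n] by blast
    have "0 \<le> C" using C[OF x0 x0] by linarith
    then show "integrable M (\<lambda>y. kernel_pow_Suc M s n x0 y * h y)"
      using C h x0 by (intro integrable_bounded[of _ "C * L"]) (auto simp: abs_mult intro!: mult_mono)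
  qed (use \<delta> x0 h c in \<open>auto intro: mult_right_mono\<close>)
  also have "\<dots> \<le> h x0"
    by (rule kernel_pow_le_iterate[OF h_meas h c super x0])
  also have "\<dots> \<le> \<epsilon> / K" using \<eta> by (simp add: h_def z_def)
  finally have avg: "(\<integral>y. h y \<partial>M) \<le> \<epsilon> / K / D" by (metis D mult.commute pos_le_divide_eq)
  have "h x \<le> \<epsilon>" if x: "x \<in> space M" for x
  proof -
    have "h x = (cmod (m z x))\<^sup>2 * (\<eta> + (\<integral>y. s x y * h y \<partial>M))"
      using QVE_Im[OF z x] by (simp add: h_def z_def)
    also have "\<dots> \<le> L\<^sup>2 * (\<epsilon> / K + B * (\<epsilon> / K / D))"
    proof (intro mult_mono power_mono add_mono)
      have "(\<integral>y. s x y * h y \<partial>M) \<le> B * (\<integral>y. h y \<partial>M)"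
        by (rule S_le[OF B(2) x h_meas h])
      also have "\<dots> \<le> B * (\<epsilon> / K / D)" using avg B by (intro mult_left_mono) auto
      finally show "(\<integral>y. s x y * h y \<partial>M) \<le> B * (\<epsilon> / K / D)" .
    qed (use L(2)[OF z x] \<eta> S_nonneg[OF x, of h] h in auto)
    also have "\<dots> = K * (\<epsilon> / K)"
    proof -
      have "L\<^sup>2 * (e + B * (e / D)) = K * e" for e
        by (simp add: K_def algebra_simps)
      then show ?thesis .
    qed
    also have "\<dots> = \<epsilon>" using K by simp
    finally show ?thesis .
  qed
  then show ?thesis using \<eta>(1,2) unfolding h_def z_def by auto
qed

section \<open>Stieltjes representation and Poisson integrals of the densities\<close>

lemma Im_resolvent: "Im (1 / (of_real t - z)) = Im z / ((t - Re z)\<^sup>2 + (Im z)\<^sup>2)"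
  by (simp add: Im_divide cmod_power2 power2_eq_square)

lemma cmod_resolvent_le: "0 < Im z \<Longrightarrow> cmod (1 / (of_real t - z)) \<le> 1 / Im z"
  using abs_Im_le_cmod[of "of_real t - z"] by (simp add: norm_divide frac_le)

text \<open>Continuity gives the value of \<open>f x\<close> at a single point a meaning, so zeros
  of the density can be discussed.\<close>

locale qve_density = qve +
  fixes v :: "'a \<Rightarrow> real measure" and f :: "'a \<Rightarrow> real \<Rightarrow> real"
  assumes v_prob: "\<And>x. x \<in> space M \<Longrightarrow> prob_space (v x) \<and> sets (v x) = sets borel"
    and v_stieltjes: "\<And>z x. 0 < Im z \<Longrightarrow> x \<in> space M \<Longrightarrow>
               m z x = (\<integral>\<tau>. 1 / (of_real \<tau> - z) \<partial>(v x))"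
    and f_dens: "\<And>x. x \<in> space M \<Longrightarrow>
               continuous_on UNIV (f x) \<and> (\<forall>\<tau>. 0 \<le> f x \<tau>)
               \<and> v x = density lborel (\<lambda>\<tau>. ennreal (f x \<tau>))"
begin

lemma f_meas: "x \<in> space M \<Longrightarrow> f x \<in> borel_measurable borel"
  using f_dens by (intro borel_measurable_continuous_onI) auto

lemma f_integral:
  assumes x: "x \<in> space M"
  shows "integrable lborel (f x)" "(\<integral>t. f x t \<partial>lborel) = 1"
proof -
  interpret V: prob_space "v x" using v_prob x by simp
  note [measurable] = f_meas[OF x]
  have nn: "\<And>t. 0 \<le> f x t" using f_dens x by simp
  have v: "v x = density lborel (\<lambda>\<tau>. ennreal (f x \<tau>))" using f_dens x by simp
  have "integrable (v x) (\<lambda>t. 1 :: real)" by simp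
  then show "integrable lborel (f x)"
    unfolding v using nn by (subst (asm) integrable_real_density) auto
  have "1 = (\<integral>t. (1 :: real) \<partial>v x)" by (simp add: V.prob_space)
  also have "\<dots> = (\<integral>t. f x t \<partial>lborel)"
    unfolding v using nn by (subst integral_real_density) auto
  finally show "(\<integral>t. f x t \<partial>lborel) = 1" by simp
qed

lemma integrable_resolvent:
  assumes "0 < Im z" "x \<in> space M"
  shows "integrable (v x) (\<lambda>t. 1 / (of_real t - z))"
proof -
  interpret V: prob_space "v x" using v_prob assms by simp
  have "(\<lambda>t. 1 / (complex_of_real t - z)) \<in> borel_measurable borel" by measurable
  then have "(\<lambda>t. 1 / (complex_of_real t - z)) \<in> borel_measurable (v x)"
    using v_prob[OF assms(2)] measurable_cong_sets[of "v x" borel] by blast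
  then show ?thesis
    using cmod_resolvent_le[OF assms(1)] by (intro V.integrable_bounded[of _ "1 / Im z"]) auto
qed

lemma Im_m_eq:
  assumes z: "0 < Im z" and x: "x \<in> space M"
  shows "integrable lborel (\<lambda>t. f x t * (Im z / ((t - Re z)\<^sup>2 + (Im z)\<^sup>2)))"
    and "Im (m z x) = (\<integral>t. f x t * (Im z / ((t - Re z)\<^sup>2 + (Im z)\<^sup>2)) \<partial>lborel)"
proof -
  note [measurable] = f_meas[OF x]
  have nn: "\<And>t. 0 \<le> f x t" using f_dens x by simp
  have v: "v x = density lborel (\<lambda>\<tau>. ennreal (f x \<tau>))" using f_dens x by simp
  have i: "integrable (v x) (\<lambda>t. Im z / ((t - Re z)\<^sup>2 + (Im z)\<^sup>2))"
    using integrable_Im[OF integrable_resolvent[OF z x]] by (simp only: Im_resolvent)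
  then show "integrable lborel (\<lambda>t. f x t * (Im z / ((t - Re z)\<^sup>2 + (Im z)\<^sup>2)))"
    unfolding v using nn by (subst (asm) integrable_real_density) auto
  have "Im (m z x) = (\<integral>t. Im z / ((t - Re z)\<^sup>2 + (Im z)\<^sup>2) \<partial>v x)"
    using integral_Im[OF integrable_resolvent[OF z x]] v_stieltjes[OF z x] by (simp only: Im_resolvent)
  also have "\<dots> = (\<integral>t. f x t * (Im z / ((t - Re z)\<^sup>2 + (Im z)\<^sup>2)) \<partial>lborel)"
    unfolding v using nn by (subst integral_real_density) auto
  finally show "Im (m z x) = (\<integral>t. f x t * (Im z / ((t - Re z)\<^sup>2 + (Im z)\<^sup>2)) \<partial>lborel)" .
qed

text \<open>By the resolvent identity \<open>m\<close> is Lipschitz in \<open>z\<close>, uniformly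
  in \<open>x\<close>, at heights bounded below. This lets a continuity argument be run in finitely
  many steps.\<close>

lemma m_diff_le:
  assumes z: "0 < Im z" and w: "0 < Im w" and x: "x \<in> space M"
  shows "cmod (m z x - m w x) \<le> cmod (z - w) / (Im z * Im w)"
proof -
  interpret V: prob_space "v x" using v_prob x by simp
  have "m z x - m w x = (\<integral>t. 1 / (of_real t - z) - 1 / (of_real t - w) \<partial>v x)"
    using v_stieltjes[OF z x] v_stieltjes[OF w x] integrable_resolvent[OF z x] integrable_resolvent[OF w x]
    by simp
  also have "cmod \<dots> \<le> (\<integral>t. cmod (1 / (of_real t - z) - 1 / (of_real t - w)) \<partial>v x)"
    by (rule integral_norm_bound)
  also have "\<dots> \<le> (\<integral>t. cmod (z - w) / (Im z * Im w) \<partial>v x)"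
  proof (intro integral_mono integrable_norm Bochner_Integration.integrable_diff integrable_resolvent z w x)
    fix t
    have "of_real t - z \<noteq> 0" "of_real t - w \<noteq> 0" using z w by (auto simp: complex_eq_iff)
    then have "1 / (of_real t - z) - 1 / (of_real t - w) = (z - w) * ((1 / (of_real t - z)) * (1 / (of_real t - w)))"
      by (simp add: field_simps)
    then have "cmod (1 / (of_real t - z) - 1 / (of_real t - w))
        = cmod (z - w) * (cmod (1 / (of_real t - z)) * cmod (1 / (of_real t - w)))"
      by (simp only: norm_mult)
    also have "\<dots> \<le> cmod (z - w) * ((1 / Im z) * (1 / Im w))"
      using z w by (intro mult_left_mono mult_mono cmod_resolvent_le) auto
    finally show "cmod (1 / (of_real t - z) - 1 / (of_real t - w)) \<le> cmod (z - w) / (Im z * Im w)"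
      by simp
  qed auto
  finally show ?thesis by (simp add: V.prob_space)
qed

text \<open>Upper bound for the Poisson integral near a zero of the density: \<open>f \<le> \<kappa>\<close> on
  \<open>[\<tau> - r, \<tau> + r]\<close> contributes at most \<open>\<kappa> \<pi>\<close>, the rest at most \<open>\<eta> / r\<^sup>2\<close>.\<close>

lemma Im_m_small_at_zero:
  assumes x: "x \<in> space M" and f0: "f x \<tau> = 0" and \<kappa>: "0 < \<kappa>"
  shows "\<exists>\<eta>. 0 < \<eta> \<and> \<eta> \<le> \<kappa> \<and> Im (m (Complex \<tau> \<eta>) x) \<le> \<kappa>"
proof -
  note [measurable] = f_meas[OF x]
  have nn: "\<And>t. 0 \<le> f x t" using f_dens x by simp
  \<comment> \<open>The Poisson kernel has mass at most \<open>pi\<close> on the window, so the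
    level \<open>\<mu>\<close> costs at most \<open>\<kappa> / 2\<close> there.\<close>
  define \<mu> where "\<mu> = \<kappa> / (2 * pi)"
  have \<mu>: "0 < \<mu>" using \<kappa> by (simp add: \<mu>_def)
  have "isCont (f x) \<tau>" using f_dens[OF x] by (simp add: continuous_on_eq_continuous_at)
  then obtain d where d: "0 < d" "\<And>t. \<bar>t - \<tau>\<bar> < d \<Longrightarrow> f x t < \<mu>"
    using \<mu> f0 nn unfolding continuous_at_eps_delta dist_real_def by (metis abs_of_nonneg diff_zero)
  define r where "r = d / 2"
  have r: "0 < r" "\<And>t. \<bar>t - \<tau>\<bar> \<le> r \<Longrightarrow> f x t \<le> \<mu>"
    using d by (auto simp: r_def less_imp_le)
  \<comment> \<open>The second entry makes the contribution \<open>\<eta> / r\<^sup>2\<close> from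
    outside the window at most \<open>\<kappa> / 2\<close>.\<close>
  define \<eta> where "\<eta> = min \<kappa> (\<kappa> / 2 * r\<^sup>2)"
  have \<eta>: "0 < \<eta>" "\<eta> \<le> \<kappa>" "\<eta> / r\<^sup>2 \<le> \<kappa> / 2"
    using \<kappa> r by (auto simp: \<eta>_def pos_divide_le_eq)
  define P where "P t = \<eta> / ((t - \<tau>)\<^sup>2 + \<eta>\<^sup>2)" for t
  have den: "0 < (t - \<tau>)\<^sup>2 + \<eta>\<^sup>2" for t using \<eta> by (simp add: add_nonneg_pos)
  have P_nonneg: "0 \<le> P t" for t using \<eta> den[of t] by (simp add: P_def)
  have "((\<lambda>t. arctan ((t - \<tau>) / \<eta>)) has_real_derivative P t) (at t)" for t
    unfolding P_def using \<eta> den[of t]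
    by (auto intro!: derivative_eq_intros simp: divide_simps power2_eq_square)
  then have "has_bochner_integral lborel (\<lambda>t. P t * indicator {\<tau> - r .. \<tau> + r} t)
      (arctan ((\<tau> + r - \<tau>) / \<eta>) - arctan ((\<tau> - r - \<tau>) / \<eta>))"
    using r P_nonneg den
    by (intro has_bochner_integral_FTC_Icc_nonneg) (auto simp: P_def intro!: continuous_intros)
  then have P_int: "integrable lborel (\<lambda>t. P t * indicator {\<tau> - r .. \<tau> + r} t)"
    and P_le: "(\<integral>t. P t * indicator {\<tau> - r .. \<tau> + r} t \<partial>lborel) \<le> pi"
    using arctan_ubound[of "r / \<eta>"] by (auto simp: has_bochner_integral_iff arctan_minus)
  have "Im (m (Complex \<tau> \<eta>) x) = (\<integral>t. f x t * P t \<partial>lborel)"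
    using Im_m_eq(2)[of "Complex \<tau> \<eta>" x] \<eta> x by (simp add: P_def)
  also have "\<dots> \<le> (\<integral>t. \<mu> * (P t * indicator {\<tau> - r .. \<tau> + r} t) + \<eta> / r\<^sup>2 * f x t \<partial>lborel)"
  proof (intro integral_mono Bochner_Integration.integrable_add integrable_mult_right P_int f_integral x)
    show "integrable lborel (\<lambda>t. f x t * P t)"
      using Im_m_eq(1)[of "Complex \<tau> \<eta>" x] \<eta> x by (simp add: P_def)
    fix t
    show "f x t * P t \<le> \<mu> * (P t * indicator {\<tau> - r .. \<tau> + r} t) + \<eta> / r\<^sup>2 * f x t"
    proof (cases "\<bar>t - \<tau>\<bar> \<le> r")
      case True
      then have "f x t * P t \<le> \<mu> * P t" using r P_nonneg by (intro mult_right_mono) auto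
      moreover have "t \<in> {\<tau> - r .. \<tau> + r}" using True by auto
      ultimately show ?thesis using \<eta> r nn[of t] by (simp add: add_increasing2)
    next
      case False
      then have "r\<^sup>2 \<le> (t - \<tau>)\<^sup>2" using r by (simp add: abs_le_square_iff[symmetric])
      then have "P t \<le> \<eta> / r\<^sup>2"
        unfolding P_def using \<eta> r by (intro divide_left_mono) (auto intro!: mult_pos_pos add_nonneg_pos add_increasing2)
      then have "f x t * P t \<le> \<eta> / r\<^sup>2 * f x t" using nn[of t] by (subst mult.commute) (rule mult_right_mono)
      moreover have "0 \<le> \<mu> * (P t * indicator {\<tau> - r .. \<tau> + r} t)" using \<mu> P_nonneg[of t] by simp
      ultimately show ?thesis by linarith
    qed
  qed
  also have "\<dots> = \<mu> * (\<integral>t. P t * indicator {\<tau> - r .. \<tau> + r} t \<partial>lborel) + \<eta> / r\<^sup>2"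
    using P_int f_integral[OF x] by (subst Bochner_Integration.integral_add) auto
  also have "\<dots> \<le> \<mu> * pi + \<kappa> / 2"
    using P_le \<mu> \<eta> by (intro add_mono mult_left_mono) auto
  also have "\<dots> = \<kappa>" by (simp add: \<mu>_def)
  finally show ?thesis using \<eta> by blast
qed

text \<open>If the density were \<open>2 \<kappa> > 0\<close> at \<open>\<tau>\<close>, it would be
  at least \<open>\<kappa>\<close> nearby. On the window of length \<open>2 * \<eta>\<close> the
  Poisson kernel is at least \<open>1 / (2 * \<eta>)\<close>, so \<open>Im m\<close> would stay
  above \<open>\<kappa>\<close> as the height tends to 0.\<close>

lemma f_zero_if_Im_linear:
  assumes x: "x \<in> space M" and K: "\<And>\<eta>. 0 < \<eta> \<Longrightarrow> Im (m (Complex \<tau> \<eta>) x) \<le> K * \<eta>"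
  shows "f x \<tau> = 0"
proof (rule ccontr)
  note [measurable] = f_meas[OF x]
  have nn: "\<And>t. 0 \<le> f x t" using f_dens x by simp
  assume "f x \<tau> \<noteq> 0"
  define \<kappa> where "\<kappa> = f x \<tau> / 2"
  have \<kappa>: "0 < \<kappa>" using nn[of \<tau>] \<open>f x \<tau> \<noteq> 0\<close> by (simp add: \<kappa>_def)
  have "isCont (f x) \<tau>" using f_dens[OF x] by (simp add: continuous_on_eq_continuous_at)
  then obtain d where d: "0 < d" "\<And>t. \<bar>t - \<tau>\<bar> < d \<Longrightarrow> \<bar>f x t - f x \<tau>\<bar> < \<kappa>"
    using \<kappa> unfolding continuous_at_eps_delta dist_real_def by metis
  have "\<kappa> \<le> K * \<eta>" if \<eta>: "0 < \<eta>" "\<eta> < d" for \<eta>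
  proof -
    have "\<kappa> = (\<integral>t. \<kappa> / (2 * \<eta>) * indicator {\<tau> - \<eta> .. \<tau> + \<eta>} t \<partial>lborel)"
      using \<eta> by simp
    also have "\<dots> \<le> (\<integral>t. f x t * (\<eta> / ((t - \<tau>)\<^sup>2 + \<eta>\<^sup>2)) \<partial>lborel)"
    proof (intro integral_mono integrable_mult_right)
      show "integrable lborel (indicator {\<tau> - \<eta> .. \<tau> + \<eta>} :: real \<Rightarrow> real)"
        using \<eta> by (intro integrable_real_indicator) auto
      show "integrable lborel (\<lambda>t. f x t * (\<eta> / ((t - \<tau>)\<^sup>2 + \<eta>\<^sup>2)))"
        using Im_m_eq(1)[of "Complex \<tau> \<eta>" x] \<eta> x by simp
      fix t
      show "\<kappa> / (2 * \<eta>) * indicator {\<tau> - \<eta> .. \<tau> + \<eta>} t \<le> f x t * (\<eta> / ((t - \<tau>)\<^sup>2 + \<eta>\<^sup>2))"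
      proof (cases "t \<in> {\<tau> - \<eta> .. \<tau> + \<eta>}")
        case True
        then have t: "\<bar>t - \<tau>\<bar> \<le> \<eta>" by auto
        then have "(t - \<tau>)\<^sup>2 \<le> \<eta>\<^sup>2" using \<eta> by (simp add: abs_le_square_iff[symmetric])
        then have "\<eta> / (2 * \<eta>\<^sup>2) \<le> \<eta> / ((t - \<tau>)\<^sup>2 + \<eta>\<^sup>2)"
          using \<eta> by (intro divide_left_mono) (auto intro!: mult_pos_pos add_nonneg_pos)
        moreover have "\<bar>f x t - f x \<tau>\<bar> < \<kappa>" using t \<eta> by (intro d) auto
        then have "\<kappa> \<le> f x t" unfolding \<kappa>_def by linarith
        ultimately have "\<kappa> * (\<eta> / (2 * \<eta>\<^sup>2)) \<le> f x t * (\<eta> / ((t - \<tau>)\<^sup>2 + \<eta>\<^sup>2))"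
          using \<kappa> \<eta> nn by (intro mult_mono) auto
        then show ?thesis using True \<eta> by (simp add: power2_eq_square)
      qed (use nn \<eta> in auto)
    qed
    also have "\<dots> = Im (m (Complex \<tau> \<eta>) x)"
      using Im_m_eq(2)[of "Complex \<tau> \<eta>" x] \<eta> x by simp
    also have "\<dots> \<le> K * \<eta>" using K \<eta> by simp
    finally show ?thesis .
  qed
  \<comment> \<open>The second entry of the minimum forces
    \<open>K * \<eta> \<le> \<kappa> / 2\<close>, whatever the sign of \<open>K\<close>.\<close>
  from this[of "min (d / 2) (\<kappa> / (2 * (\<bar>K\<bar> + 1)))"] d \<kappa>
  have "\<kappa> \<le> K * min (d / 2) (\<kappa> / (2 * (\<bar>K\<bar> + 1)))" by (auto simp: min_less_iff_disj)
  also have "\<dots> \<le> (\<bar>K\<bar> + 1) * (\<kappa> / (2 * (\<bar>K\<bar> + 1)))"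
    using d \<kappa> by (intro mult_mono) auto
  also have "\<dots> = \<kappa> / 2" by (simp add: field_simps)
  finally show False using \<kappa> by simp
qed

end

section \<open>Propagation of a sign pattern\<close>

context qve_density
begin

text \<open>A real sign pattern at one point freezes the solution on the corresponding side:
  with \<open>u = \<bar>m z0\<bar>\<close>, the set \<open>\<bar>m\<bar> \<le> u\<close> is mapped by the equation into \<open>\<bar>m\<bar> \<le> u / (1 + \<delta> u / 2)\<close>,
  so by continuity \<open>m\<close> never leaves it when \<open>Im z\<close> decreases from infinity.  Since
  \<open>Im (m z0)\<close> is a supersolution for \<open>u\<^sup>2 S\<close>, the strict gain bounds \<open>Im m\<close> linearly in \<open>Im z\<close>.\<close>

lemma density_zero_beyond:
  assumes sg: "sg = 1 \<or> sg = (- 1 :: real)" and z0: "0 < Im z0"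
    and sign: "\<And>x. x \<in> space M \<Longrightarrow> 0 \<le> sg * Re (m z0 x)"
    and b: "0 < b" "\<And>x. x \<in> space M \<Longrightarrow> b \<le> cmod (m z0 x)"
    and \<epsilon>: "\<And>x. x \<in> space M \<Longrightarrow> Im (m z0 x) \<le> \<epsilon>"
    and B: "0 < B" "\<And>x y. x \<in> space M \<Longrightarrow> y \<in> space M \<Longrightarrow> s x y \<le> B"
    and \<delta>: "0 < \<delta>" and small: "\<epsilon> * (1 / b\<^sup>2 + B) \<le> \<delta> / 2"
    and far: "\<delta> \<le> sg * (Re z0 - \<tau>)"
    and x0: "x0 \<in> space M"
  shows "f x0 \<tau> = 0"
proof -
  note [measurable] = m_meas[OF z0]
  define u where "u x = cmod (m z0 x)" for x
  define h0 where "h0 x = Im (m z0 x)" for x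
  have [measurable]: "u \<in> borel_measurable M" "h0 \<in> borel_measurable M"
    unfolding u_def h0_def by measurable
  define U where "U = 1 / Im z0"
  have U: "0 < U" "u x \<le> U" if "x \<in> space M" for x
    using z0 cmod_m_le[OF z0] that by (auto simp: U_def u_def)
  have "0 < U" using U x0 by simp
  have upos: "0 < u x" if "x \<in> space M" for x using b that by (fastforce simp: u_def)
  define \<theta> where "\<theta> = \<delta> / 2"
  have \<theta>: "0 < \<theta>" using \<delta> by (simp add: \<theta>_def)
  define w where "w x = u x / (1 + \<theta> * u x)" for x
  have h0_le: "h0 x \<le> \<epsilon>" "0 < h0 x" "h0 x \<le> u x" if "x \<in> space M" for x
    using \<epsilon> m_H[OF z0] that abs_Im_le_cmod[of "m z0 x"] by (auto simp: h0_def u_def)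
  have "0 \<le> \<epsilon>" using h0_le[OF x0] by linarith
  \<comment> \<open>Self-improvement. If \<open>\<bar>m\<bar> \<le> u\<close>, then
    \<open>sg * Re m\<close> exceeds \<open>sg * Re (m z0)\<close> by at most
    \<open>\<epsilon>\<close>, because \<open>m z0\<close> is nearly real with sign
    \<open>sg\<close>. In the real part of the equation the shift by \<open>\<delta>\<close>
    outweighs the errors, which use up at most half of it; the other half is the gain
    \<open>\<theta>\<close> in \<open>1 / \<bar>m\<bar>\<close>.\<close>
  have key: "cmod (m z x) \<le> w x"
    if z: "0 < Im z" "Re z = \<tau>" and le: "\<And>y. y \<in> space M \<Longrightarrow> cmod (m z y) \<le> u y" and x: "x \<in> space M" for z x
  proof -
    note [measurable] = m_meas[OF z(1)]
    have sg_abs: "\<bar>sg * t\<bar> = \<bar>t\<bar>" for t using sg by auto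
    have "(\<integral>y. s x y * (sg * Re (m z y)) \<partial>M) \<le> (\<integral>y. s x y * (sg * Re (m z0 y) + \<epsilon>) \<partial>M)"
    proof (rule S_mono[OF x, of _ U _ "U + \<epsilon>"])
      fix y assume y: "y \<in> space M"
      show "\<bar>sg * Re (m z y)\<bar> \<le> U"
        using le[OF y] U[OF y] abs_Re_le_cmod[of "m z y"] by (simp add: sg_abs)
      show "\<bar>sg * Re (m z0 y) + \<epsilon>\<bar> \<le> U + \<epsilon>"
        using U[OF y] abs_Re_le_cmod[of "m z0 y"] sign[OF y] \<open>0 \<le> \<epsilon>\<close> sg_abs[of "Re (m z0 y)"] by (simp add: u_def)
      have "sg * Re (m z y) \<le> u y"
        using le[OF y] abs_Re_le_cmod[of "m z y"] sg_abs[of "Re (m z y)"] by linarith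
      also have "u y \<le> \<bar>Re (m z0 y)\<bar> + \<bar>Im (m z0 y)\<bar>" unfolding u_def by (rule cmod_le)
      also have "\<dots> \<le> sg * Re (m z0 y) + \<epsilon>"
        using sign[OF y] sg_abs[of "Re (m z0 y)"] h0_le[OF y] by (simp add: h0_def)
      finally show "sg * Re (m z y) \<le> sg * Re (m z0 y) + \<epsilon>" .
    qed measurable
    also have "\<dots> = (\<integral>y. sg * (s x y * Re (m z0 y)) + s x y * \<epsilon> \<partial>M)"
      by (simp add: algebra_simps)
    also have "\<dots> = sg * (\<integral>y. s x y * Re (m z0 y) \<partial>M) + (\<integral>y. s x y * \<epsilon> \<partial>M)"
    proof (subst Bochner_Integration.integral_add)
      obtain D where "\<forall>x\<in>space M. \<bar>Re (m z0 x)\<bar> \<le> D" using Re_bdd[OF z0] by blast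
      then show "integrable M (\<lambda>y. sg * (s x y * Re (m z0 y)))"
        by (intro integrable_mult_right integrable_s_mult[OF x, of _ D]) auto
      show "integrable M (\<lambda>y. s x y * \<epsilon>)" by (intro integrable_s_mult[OF x, of _ "\<bar>\<epsilon>\<bar>"]) auto
    qed simp
    also have "(\<integral>y. s x y * \<epsilon> \<partial>M) \<le> B * \<epsilon>"
      using S_le[OF B(2) x, of "\<lambda>_. \<epsilon>" \<epsilon>] \<open>0 \<le> \<epsilon>\<close> by (simp add: prob_space)
    finally have S: "sg * (\<integral>y. s x y * Re (m z y) \<partial>M) \<le> sg * (\<integral>y. s x y * Re (m z0 y) \<partial>M) + B * \<epsilon>"
      by (simp add: mult.left_commute)
    \<comment> \<open>Nearly all of \<open>\<bar>m z0\<bar>\<close> sits in its real part; dividing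
      by \<open>u\<^sup>2\<close> produces, up to sign, the left side of
      \<open>QVE_Re\<close>.\<close>
    have "u x - \<epsilon> \<le> sg * Re (m z0 x)"
      using cmod_le[of "m z0 x"] sign[OF x] sg_abs[of "Re (m z0 x)"] h0_le[OF x] by (simp add: u_def h0_def)
    then have "(u x - \<epsilon>) / (u x)\<^sup>2 \<le> sg * Re (m z0 x) / (u x)\<^sup>2"
      by (intro divide_right_mono) auto
    also have "\<dots> = - sg * (Re z0 + a x + (\<integral>y. s x y * Re (m z0 y) \<partial>M))"
      using QVE_Re[OF z0 x] by (simp add: u_def flip: QVE_Re[OF z0 x])
    finally have 0: "1 / u x - \<epsilon> / (u x)\<^sup>2 \<le> - sg * (Re z0 + a x + (\<integral>y. s x y * Re (m z0 y) \<partial>M))"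
      using upos[OF x] by (simp add: diff_divide_distrib power2_eq_square)
    have "\<epsilon> / (u x)\<^sup>2 \<le> \<epsilon> / b\<^sup>2"
      using b(1) b(2)[OF x] \<open>0 \<le> \<epsilon>\<close> by (intro frac_le power_mono) (auto simp: u_def)
    moreover have "\<epsilon> * (1 / b\<^sup>2 + B) = \<epsilon> / b\<^sup>2 + B * \<epsilon>" by (simp add: distrib_left)
    ultimately have "\<epsilon> / (u x)\<^sup>2 + B * \<epsilon> \<le> \<theta>"
      using small unfolding \<theta>_def by linarith
    moreover have "- sg * (p + a x + q) = - (sg * p) - sg * a x - sg * q" for p q
      by (simp add: algebra_simps)
    moreover have "2 * \<theta> \<le> sg * Re z0 - sg * \<tau>"
      using far by (simp add: \<theta>_def right_diff_distrib)
    ultimately have "1 / u x + \<theta> \<le> - sg * (\<tau> + a x + (\<integral>y. s x y * Re (m z y) \<partial>M))"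
      using 0 S by smt
    also have "\<dots> = - sg * Re (- 1 / m z x)"
      using Re_S[OF z(1) x] arg_cong[OF QVE[OF z(1) x], of Re] z(2) by simp
    also have "\<dots> \<le> \<bar>Re (- 1 / m z x)\<bar>" using sg by auto
    also have "\<dots> \<le> cmod (- 1 / m z x)" by (rule abs_Re_le_cmod)
    finally have "1 / u x + \<theta> \<le> 1 / cmod (m z x)" by (simp add: norm_divide)
    moreover have "0 < cmod (m z x)" using m_nonzero[OF z(1) x] by simp
    ultimately show ?thesis
      using upos[OF x] \<theta> unfolding w_def by (simp add: field_simps add_pos_pos)
  qed
  \<comment> \<open>A uniform lower bound for
    \<open>u - w = \<theta> u\<^sup>2 / (1 + \<theta> u)\<close>, from
    \<open>b \<le> u \<le> U\<close>.\<close>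
  define \<kappa> where "\<kappa> = \<theta> * b\<^sup>2 / (1 + \<theta> * U)"
  have \<kappa>: "0 < \<kappa>" using \<theta> b \<open>0 < U\<close> by (simp add: \<kappa>_def add_pos_pos)
  have gap: "w x + \<kappa> \<le> u x" if x: "x \<in> space M" for x
  proof -
    have "\<kappa> \<le> \<theta> * (u x)\<^sup>2 / (1 + \<theta> * u x)"
      unfolding \<kappa>_def using \<theta> b(1) b(2)[OF x] U[OF x] upos[OF x]
      by (intro frac_le mult_left_mono power_mono) (auto simp: u_def add_pos_nonneg)
    also have "\<dots> = u x - w x"
    proof -
      have "0 < 1 + \<theta> * u x" using \<theta> upos[OF x] by (simp add: add_pos_pos)
      then show ?thesis by (simp add: w_def field_simps power2_eq_square)
    qed
    finally show ?thesis by simp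
  qed
  have below: "cmod (m (Complex \<tau> \<eta>) x) \<le> u x" if \<eta>: "0 < \<eta>" and x: "x \<in> space M" for \<eta> x
  proof -
    \<comment> \<open>Discrete descent in the height: at heights at least \<open>\<eta>\<close>, a
      step of length \<open>t\<close> changes \<open>m\<close> by at most
      \<open>t / \<eta>\<^sup>2 = \<kappa>\<close>, which the gap between \<open>w\<close> and
      \<open>u\<close> absorbs.\<close>
    define t where "t = \<kappa> * \<eta>\<^sup>2"
    have t: "0 < t" using \<kappa> \<eta> by (simp add: t_def)
    \<comment> \<open>The descent starts at height at least \<open>1 / b\<close>, where
      \<open>cmod_m_le\<close> gives \<open>\<bar>m\<bar> \<le> b \<le> u\<close>; the maximum stops
      it at \<open>\<eta>\<close>.\<close>
    define e where "e n = max \<eta> (1 / b - real n * t)" for n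
    have e_ge: "\<eta> \<le> e n" for n by (simp add: e_def)
    have e_pos: "0 < e n" for n using e_ge[of n] \<eta> by linarith
    have all: "cmod (m (Complex \<tau> (e n)) x) \<le> u x" if "x \<in> space M" for n x
      using that
    proof (induction n arbitrary: x)
      case 0
      have "cmod (m (Complex \<tau> (e 0)) x) \<le> 1 / e 0"
        using cmod_m_le[of "Complex \<tau> (e 0)" x] e_pos[of 0] 0 by simp
      also have "\<dots> \<le> 1 / (1 / b)" using b by (intro frac_le) (auto simp: e_def)
      also have "\<dots> \<le> u x" using b 0 by (simp add: u_def)
      finally show ?case .
    next
      case (Suc n)
      let ?z = "Complex \<tau> (e n)" and ?w = "Complex \<tau> (e (Suc n))"
      have "cmod (m ?w x) \<le> cmod (m ?z x) + cmod (m ?z x - m ?w x)"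
        by (metis norm_triangle_sub norm_minus_commute)
      also have "cmod (m ?z x) \<le> w x"
        using Suc e_pos by (intro key) auto
      also have "cmod (m ?z x - m ?w x) \<le> cmod (?z - ?w) / (e n * e (Suc n))"
        using m_diff_le[of ?z ?w x] e_pos Suc.prems by simp
      also have "\<dots> \<le> t / (\<eta> * \<eta>)"
      proof (intro frac_le mult_mono)
        have "?z - ?w = \<i> * of_real (e n - e (Suc n))" by (simp add: complex_eq_iff)
        then have "cmod (?z - ?w) = \<bar>e n - e (Suc n)\<bar>" by (simp only: norm_mult norm_of_real) simp
        also have "\<dots> \<le> t" using t by (auto simp: e_def algebra_simps max_def)
        finally show "cmod (?z - ?w) \<le> t" .
      qed (use e_ge[of n] e_ge[of "Suc n"] \<eta> t in auto)
      also have "\<dots> = \<kappa>" using \<eta> by (simp add: t_def power2_eq_square)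
      also have "w x + \<kappa> \<le> u x" by (rule gap[OF Suc.prems])
      finally show ?case by simp
    qed
    obtain n where "1 / b / t < real n" using reals_Archimedean2 by blast
    then have "1 / b < real n * t" by (rule pos_divide_less_eq[OF t, THEN iffD1])
    then have "e n = \<eta>" using \<eta> by (simp add: e_def)
    then show ?thesis using all[OF x, of n] by simp
  qed
  obtain c where c: "0 < c" "\<And>x. x \<in> space M \<Longrightarrow> c \<le> h0 x"
    using Im_m_pos_lower[OF z0] unfolding h0_def by metis
  \<comment> \<open>\<open>q\<close> is the contraction factor gained by passing from
    \<open>u\<^sup>2\<close> to \<open>w\<^sup>2\<close>, made uniform through
    \<open>u \<ge> b\<close>.\<close>
  define q where "q = (1 / (1 + \<theta> * b))\<^sup>2"
  have q: "0 \<le> q" "q < 1"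
  proof -
    have "0 < \<theta> * b" using \<theta> b(1) by simp
    then have "0 \<le> 1 / (1 + \<theta> * b)" "1 / (1 + \<theta> * b) < 1" by auto
    then show "0 \<le> q" "q < 1" unfolding q_def by (auto simp only: power_less_one_iff zero_le_power2)
  qed
  have wq: "(w x)\<^sup>2 \<le> q * (u x)\<^sup>2" if x: "x \<in> space M" for x
  proof -
    have "w x \<le> u x / (1 + \<theta> * b)"
      unfolding w_def using \<theta> b(1) b(2)[OF x] upos[OF x]
      by (intro divide_left_mono) (auto simp: u_def intro!: mult_pos_pos add_pos_pos)
    moreover have "0 \<le> w x" using upos[OF x] \<theta> by (simp add: w_def)
    ultimately have "(w x)\<^sup>2 \<le> (u x / (1 + \<theta> * b))\<^sup>2" by (intro power_mono)
    then show ?thesis by (simp add: q_def power_divide)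
  qed
  show ?thesis
  proof (rule f_zero_if_Im_linear[OF x0])
    fix \<eta> :: real assume \<eta>: "0 < \<eta>"
    define z where "z = Complex \<tau> \<eta>"
    have z: "0 < Im z" "Re z = \<tau>" "Im z = \<eta>" using \<eta> by (auto simp: z_def)
    note [measurable] = m_meas[OF z(1)]
    define h where "h x = Im (m z x)" for x
    have h_meas [measurable]: "h \<in> borel_measurable M" unfolding h_def by measurable
    have h: "0 < h x" "h x \<le> U" if "x \<in> space M" for x
      using m_H[OF z(1) that] below[OF \<eta> that] U[OF that] abs_Im_le_cmod[of "m z x"]
      by (auto simp: h_def z_def)
    \<comment> \<open>\<open>T\<close> is the least constant with \<open>h \<le> T * h0\<close>. The
      lower bound \<open>c\<close> on \<open>h0\<close> makes it finite, which the absorption of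
      \<open>q * T\<close> below requires.\<close>
    define T where "T = (SUP x\<in>space M. h x / h0 x)"
    have "h x / h0 x \<le> U / c" if "x \<in> space M" for x
      using h[OF that] c(2)[OF that] c(1) by (intro frac_le) auto
    then have bdd: "bdd_above ((\<lambda>x. h x / h0 x) ` space M)" by (auto intro!: bdd_aboveI2)
    have hT: "h x \<le> T * h0 x" if "x \<in> space M" for x
      using cSUP_upper[OF that bdd] h0_le(2)[OF that] by (simp add: T_def pos_divide_le_eq)
    have "0 \<le> T" using hT[OF x0] h[OF x0] h0_le(2)[OF x0]
      by (smt (verit) mult_nonpos_nonneg)
    \<comment> \<open>Insert \<open>h \<le> T * h0\<close> into the equation for \<open>h\<close>:
      the factor \<open>\<bar>m\<bar>\<^sup>2 \<le> q u\<^sup>2\<close> meets \<open>S h0\<close>,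
      and \<open>u\<^sup>2 S h0 \<le> h0\<close>.\<close>
    have "h x / h0 x \<le> U\<^sup>2 / c * \<eta> + q * T" if x: "x \<in> space M" for x
    proof -
      have S_h: "0 \<le> (\<integral>y. s x y * h y \<partial>M)" using h by (intro S_nonneg[OF x]) (auto simp: less_imp_le)
      have S_h0: "0 \<le> (\<integral>y. s x y * h0 y \<partial>M)" using h0_le by (intro S_nonneg[OF x]) (auto simp: less_imp_le)
      have "cmod (m z x) \<le> w x"
        using below[OF \<eta>] by (intro key z x) (auto simp: z_def)
      then have "(cmod (m z x))\<^sup>2 \<le> (w x)\<^sup>2" by (intro power_mono) auto
      then have w2: "(cmod (m z x))\<^sup>2 \<le> q * (u x)\<^sup>2" using wq[OF x] by linarith
      have "cmod (m z x) \<le> U" using below[OF \<eta> x] U[OF x] by (auto simp: z_def)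
      then have U2: "(cmod (m z x))\<^sup>2 \<le> U\<^sup>2" by (intro power_mono) auto
      have "h x = (cmod (m z x))\<^sup>2 * \<eta> + (cmod (m z x))\<^sup>2 * (\<integral>y. s x y * h y \<partial>M)"
        using QVE_Im[OF z(1) x] z by (simp add: h_def distrib_left)
      also have "\<dots> \<le> U\<^sup>2 * \<eta> + q * (u x)\<^sup>2 * (\<integral>y. s x y * h y \<partial>M)"
        using U2 w2 \<eta> S_h by (intro add_mono mult_right_mono) auto
      also have "(\<integral>y. s x y * h y \<partial>M) \<le> (\<integral>y. s x y * (T * h0 y) \<partial>M)"
      proof (rule S_mono[OF x, of _ U _ "T * U"])
        show "\<bar>T * h0 y\<bar> \<le> T * U" if "y \<in> space M" for y
          using h0_le[OF that] U[OF that] \<open>0 \<le> T\<close> by (auto simp: abs_mult intro!: mult_mono)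
      qed (use h hT in \<open>auto simp: less_imp_le\<close>)
      also have "\<dots> = T * (\<integral>y. s x y * h0 y \<partial>M)" by (simp add: mult.left_commute)
      also have "q * (u x)\<^sup>2 * (T * (\<integral>y. s x y * h0 y \<partial>M)) = q * T * ((u x)\<^sup>2 * (\<integral>y. s x y * h0 y \<partial>M))"
        by simp
      also have "\<dots> \<le> q * T * h0 x"
        using S_Im_le[OF z0 x] q \<open>0 \<le> T\<close> by (intro mult_left_mono) (auto simp: u_def h0_def)
      finally have "h x \<le> U\<^sup>2 * \<eta> + q * T * h0 x"
        using q by (simp add: mult_left_mono)
      then have "h x / h0 x \<le> (U\<^sup>2 * \<eta> + q * T * h0 x) / h0 x"
        using h0_le(2)[OF x] by (intro divide_right_mono) auto
      also have "\<dots> = U\<^sup>2 * \<eta> / h0 x + q * T" using h0_le(2)[OF x] by (simp add: add_divide_distrib)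
      also have "U\<^sup>2 * \<eta> / h0 x \<le> U\<^sup>2 * \<eta> / c"
        using c(1) c(2)[OF x] \<eta> by (intro divide_left_mono) auto
      finally show ?thesis by simp
    qed
    then have "T \<le> U\<^sup>2 / c * \<eta> + q * T"
      unfolding T_def using x0 by (intro cSUP_least) auto
    then have "T * (1 - q) \<le> U\<^sup>2 / c * \<eta>" by (simp add: algebra_simps)
    then have "T \<le> U\<^sup>2 / c * \<eta> / (1 - q)" using q by (intro pos_le_divide_eq[THEN iffD2]) auto
    then have T: "T \<le> U\<^sup>2 / c / (1 - q) * \<eta>" by simp
    have "h x0 \<le> T * h0 x0" by (rule hT[OF x0])
    also have "\<dots> \<le> T * U" using h0_le[OF x0] U[OF x0] \<open>0 \<le> T\<close> by (intro mult_left_mono) auto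
    also have "\<dots> \<le> U\<^sup>2 / c / (1 - q) * \<eta> * U" using T \<open>0 < U\<close> by (intro mult_right_mono) auto
    finally show "Im (m (Complex \<tau> \<eta>) x0) \<le> U\<^sup>2 / c / (1 - q) * U * \<eta>"
      by (simp add: h_def z_def mult_ac)
  qed
qed

end

section \<open>Conclusion: no interior zero, hence no gap and no cusp\<close>

theorem mainTheorem3:
  fixes M :: "'a measure" and a :: "'a \<Rightarrow> real" and s :: "'a \<Rightarrow> 'a \<Rightarrow> real"
    and m :: "complex \<Rightarrow> 'a \<Rightarrow> complex"
    and v :: "'a \<Rightarrow> real measure" and f :: "'a \<Rightarrow> real \<Rightarrow> real"
  assumes prob: "prob_space M"
    and a_bdd: "bdd_meas M a"
    and s_ker: "sym_kernel M s"
    and m_meas: "\<And>z. 0 < Im z \<Longrightarrow> m z \<in> borel_measurable M"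
    and m_bdd: "\<And>z. 0 < Im z \<Longrightarrow> \<exists>C. \<forall>x\<in>space M. cmod (m z x) \<le> C"
    and m_H: "\<And>z x. 0 < Im z \<Longrightarrow> x \<in> space M \<Longrightarrow> 0 < Im (m z x)"
    and QVE: "\<And>z x. 0 < Im z \<Longrightarrow> x \<in> space M \<Longrightarrow>
               - 1 / m z x = z + of_real (a x) + (\<integral>y. of_real (s x y) * m z y \<partial>M)"
    and v_prob: "\<And>x. x \<in> space M \<Longrightarrow> prob_space (v x) \<and> sets (v x) = sets borel"
    and v_stieltjes: "\<And>z x. 0 < Im z \<Longrightarrow> x \<in> space M \<Longrightarrow>
               m z x = (\<integral>\<tau>. 1 / (of_real \<tau> - z) \<partial>(v x))"
    and f_dens: "\<And>x. x \<in> space M \<Longrightarrow>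
               continuous_on UNIV (f x) \<and> (\<forall>\<tau>. 0 \<le> f x \<tau>)
               \<and> v x = density lborel (\<lambda>\<tau>. ennreal (f x \<tau>))"
    and A: "\<exists>r. sym_kernel M r
              \<and> (\<forall>x\<in>space M. \<forall>y\<in>space M. (\<integral>u. r x u * r u y \<partial>M) \<le> s x y)
              \<and> (\<exists>\<delta>>0. \<forall>x\<in>space M. \<delta> \<le> (\<integral>y. r x y \<partial>M))"
    and B: "\<exists>K. \<exists>\<delta>>0. \<forall>x\<in>space M. \<forall>y\<in>space M. \<delta> \<le> kernel_pow_Suc M s K x y"
    and C: "\<forall>B::real. \<exists>\<epsilon>\<^sub>0>0. \<forall>\<epsilon>. 0 < \<epsilon> \<and> \<epsilon> < \<epsilon>\<^sub>0 \<longrightarrow> (\<forall>x\<in>space M.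
              B \<le> (\<integral>y. 1 / (\<epsilon> + (a x - a y)\<^sup>2 + (\<integral>u. (s x u - s y u)\<^sup>2 \<partial>M)) \<partial>M))"
    and D: "\<forall>A\<in>sets M. A \<noteq> {} \<and> A \<noteq> space M \<longrightarrow>
              (\<forall>\<epsilon>>0. \<exists>x\<in>A. \<exists>y\<in>space M - A.
                 \<bar>a x - a y\<bar> + (\<integral>u. \<bar>s x u - s y u\<bar> \<partial>M) < \<epsilon>)"
  shows "\<forall>x\<^sub>0\<in>space M.
           is_interval {\<tau>. 0 < f x\<^sub>0 \<tau>}
         \<and> \<not> (\<exists>\<tau>\<^sub>0\<in>frontier {\<tau>. 0 < f x\<^sub>0 \<tau>}. \<exists>c. bdd_meas M c
                 \<and> (\<exists>\<delta>>0. \<forall>x\<in>space M. \<delta> \<le> c x)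
                 \<and> (\<exists>K>0. \<exists>\<eta>>0. \<forall>\<omega>. \<bar>\<omega>\<bar> < \<eta> \<longrightarrow> (\<forall>x\<in>space M.
                      \<bar>f x (\<tau>\<^sub>0 + \<omega>) - c x * \<bar>\<omega>\<bar> powr (1/3)\<bar> \<le> K * \<bar>\<omega>\<bar> powr (2/3))))"
proof -
  interpret prob_space M by (rule prob)
  interpret qve_density M a s m v f
    by unfold_locales (fact a_bdd s_ker m_meas m_H m_bdd QVE v_prob v_stieltjes f_dens)+
  obtain L where L: "0 < L" "\<And>z x. 0 < Im z \<Longrightarrow> x \<in> space M \<Longrightarrow> cmod (m z x) \<le> L"
    by (rule m_sup_bound[OF A C]) blast
  obtain S where S: "0 < S" "\<And>x y. x \<in> space M \<Longrightarrow> y \<in> space M \<Longrightarrow> s x y \<le> S"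
    by (rule s_bound) blast
  \<comment> \<open>Both claims reduce to this: a density cannot vanish strictly between two points
    where it is positive.\<close>
  have no_zero: False
    if x0: "x0 \<in> space M" and zero: "f x0 \<tau> = 0"
      and t1: "t1 < \<tau>" "0 < f x0 t1" and t2: "\<tau> < t2" "0 < f x0 t2" for x0 \<tau> t1 t2
  proof -
    define \<delta> where "\<delta> = min (\<tau> - t1) (t2 - \<tau>)"
    have \<delta>: "0 < \<delta>" using t1 t2 by (simp add: \<delta>_def)
    obtain b where b: "0 < b"
      "\<And>\<eta> x. 0 < \<eta> \<Longrightarrow> \<eta> \<le> 1 \<Longrightarrow> x \<in> space M \<Longrightarrow> b \<le> cmod (m (Complex \<tau> \<eta>) x)"
      by (rule m_lower_bound[OF L, of \<tau>]) blast+
    \<comment> \<open>\<open>b / 2\<close> makes the real part of \<open>m\<close> carry at least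
      half of the modulus; the other entry is the smallness condition of
      \<open>density_zero_beyond\<close>.\<close>
    define \<epsilon> where "\<epsilon> = min (b / 2) (\<delta> / 2 / (1 / b\<^sup>2 + S))"
    have den: "0 < 1 / b\<^sup>2 + S" using b S by (simp add: add_pos_pos)
    have \<epsilon>: "0 < \<epsilon>" using b \<delta> den by (simp add: \<epsilon>_def)
    have "\<epsilon> \<le> \<delta> / 2 / (1 / b\<^sup>2 + S)" by (simp add: \<epsilon>_def)
    then have small: "\<epsilon> * (1 / b\<^sup>2 + S) \<le> \<delta> / 2" by (rule pos_le_divide_eq[OF den, THEN iffD1])
    obtain \<eta> where \<eta>: "0 < \<eta>" "\<eta> \<le> 1" "\<And>x. x \<in> space M \<Longrightarrow> Im (m (Complex \<tau> \<eta>) x) \<le> \<epsilon>"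
      using Im_uniformly_small[OF B L x0 Im_m_small_at_zero[OF x0 zero] \<epsilon>] by blast
    define z where "z = Complex \<tau> \<eta>"
    have z: "0 < Im z" "Re z = \<tau>" using \<eta> by (auto simp: z_def)
    note [measurable] = m_meas[OF z(1)]
    have bz: "b \<le> cmod (m z x)" and iz: "Im (m z x) \<le> \<epsilon>" if "x \<in> space M" for x
      using b \<eta> that by (auto simp: z_def)
    have Re_inv: "1 / (2 * L) \<le> \<bar>Re (1 / m z x)\<bar>" if x: "x \<in> space M" for x
    proof -
      have pos: "0 < cmod (m z x)" using m_nonzero[OF z(1) x] by simp
      have "cmod (m z x) \<le> \<bar>Re (m z x)\<bar> + \<epsilon>"
        using cmod_le[of "m z x"] m_H[OF z(1) x] iz[OF x] by linarith
      moreover have "\<epsilon> \<le> b / 2" unfolding \<epsilon>_def by (rule min.cobounded1)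
      ultimately have "cmod (m z x) / 2 \<le> \<bar>Re (m z x)\<bar>" using bz[OF x] by linarith
      then have "cmod (m z x) / 2 / (cmod (m z x))\<^sup>2 \<le> \<bar>Re (m z x)\<bar> / (cmod (m z x))\<^sup>2"
        by (intro divide_right_mono) auto
      moreover have "Re (1 / m z x) = Re (m z x) / (cmod (m z x))\<^sup>2"
        by (simp add: Re_divide cmod_power2)
      ultimately have "1 / (2 * cmod (m z x)) \<le> \<bar>Re (1 / m z x)\<bar>"
        using pos by (simp add: power2_eq_square)
      moreover have "1 / (2 * L) \<le> 1 / (2 * cmod (m z x))"
        using L(2)[OF z(1) x] pos by (intro divide_left_mono) (auto intro!: mult_pos_pos L)
      ultimately show ?thesis by linarith
    qed
    define P where "P = {x \<in> space M. 0 \<le> Re (m z x)}"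
    have "P \<in> sets M" unfolding P_def by measurable
    \<comment> \<open>Across a change of sign the real parts of \<open>1 / m\<close> differ by at
      least \<open>1 / L\<close> by \<open>Re_inv\<close>, whereas \<open>D\<close> supplies points
      on both sides where \<open>1 / m\<close> differs by less.\<close>
    have "P = {} \<or> P = space M"
    proof (rule ccontr)
      assume "\<not> (P = {} \<or> P = space M)"
      \<comment> \<open>With this threshold, \<open>\<alpha> + \<beta> * L \<le> (\<alpha> +
        \<beta>) * (1 + L) < 1 / L\<close> for the two summands \<alpha> and \<beta> in
        \<open>D\<close>.\<close>
      moreover have "0 < 1 / (L * (1 + L))" using L by simp
      ultimately obtain x y where xy: "x \<in> P" "y \<in> space M - P"
        and close: "\<bar>a x - a y\<bar> + (\<integral>u. \<bar>s x u - s y u\<bar> \<partial>M) < 1 / (L * (1 + L))"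
        using D \<open>P \<in> sets M\<close> by meson
      then have x: "x \<in> space M" "0 \<le> Re (m z x)" and y: "y \<in> space M" "Re (m z y) < 0"
        by (auto simp: P_def)
      have "0 \<le> Re (1 / m z x)" using x(2) by (simp add: Re_divide)
      moreover have "Re (1 / m z y) \<le> 0" using y(2) by (simp add: Re_divide divide_nonpos_nonneg)
      ultimately have "1 / L \<le> \<bar>Re (1 / m z x - 1 / m z y)\<bar>"
        using Re_inv[OF x(1)] Re_inv[OF y(1)] L(1) by (simp add: field_simps)
      also have "\<dots> \<le> cmod (1 / m z x - 1 / m z y)" by (rule abs_Re_le_cmod)
      also have "\<dots> \<le> \<bar>a x - a y\<bar> + (\<integral>u. \<bar>s x u - s y u\<bar> * cmod (m z u) \<partial>M)"
        by (rule inverse_diff_le[OF z(1) x(1) y(1)])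
      also have "(\<integral>u. \<bar>s x u - s y u\<bar> * cmod (m z u) \<partial>M) \<le> (\<integral>u. \<bar>s x u - s y u\<bar> * L \<partial>M)"
      proof (intro integral_mono mult_left_mono L z)
        obtain R where R: "0 < R" "\<And>x y u. x \<in> space M \<Longrightarrow> y \<in> space M \<Longrightarrow> u \<in> space M \<Longrightarrow> \<bar>s x u - s y u\<bar> \<le> R"
          by (rule row_diff_bound) blast
        have i: "integrable M (\<lambda>u. \<bar>s x u - s y u\<bar>)"
          using R x y by (intro integrable_bounded[of _ R]) auto
        then show "integrable M (\<lambda>u. \<bar>s x u - s y u\<bar> * L)" by simp
        show "integrable M (\<lambda>u. \<bar>s x u - s y u\<bar> * cmod (m z u))"
          using R x y L(2)[OF z(1)]
          by (intro integrable_bounded[of _ "R * L"]) (auto simp: abs_mult intro!: mult_mono)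
      qed auto
      also have "\<dots> = (\<integral>u. \<bar>s x u - s y u\<bar> \<partial>M) * L" by simp
      finally have "1 / L \<le> \<bar>a x - a y\<bar> + (\<integral>u. \<bar>s x u - s y u\<bar> \<partial>M) * L" by simp
      also have "\<dots> \<le> (\<bar>a x - a y\<bar> + (\<integral>u. \<bar>s x u - s y u\<bar> \<partial>M)) * (1 + L)"
        using L(1) by (simp add: algebra_simps)
      also have "\<dots> < 1 / (L * (1 + L)) * (1 + L)"
        using close L(1) by (intro mult_strict_right_mono) auto
      also have "\<dots> = 1 / L"
      proof -
        have "1 + L \<noteq> 0" using L(1) by simp
        then show ?thesis by simp
      qed
      finally show False by simp
    qed
    then show False
    proof
      \<comment> \<open>Positive real part: the density vanishes to the left at distance at least
        \<delta>, in particular at \<open>t1\<close>. The other case is the mirror image at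
        \<open>t2\<close>.\<close>
      assume "P = space M"
      then have "f x0 t1 = 0"
        using bz iz \<delta> small z x0 S b(1)
        by (intro density_zero_beyond[where sg = 1 and \<delta> = \<delta> and B = S and ?z0.0 = z and b = b and \<epsilon> = \<epsilon>])
          (auto simp: P_def \<delta>_def)
      then show False using t1 by simp
    next
      assume "P = {}"
      then have "f x0 t2 = 0"
        using bz iz \<delta> small z x0 S b(1)
        by (intro density_zero_beyond[where sg = "-1" and \<delta> = \<delta> and B = S and ?z0.0 = z and b = b and \<epsilon> = \<epsilon>])
          (auto simp: P_def \<delta>_def not_le less_imp_le)
      then show False using t2 by simp
    qed
  qed
  show ?thesis
  proof (intro ballI conjI)
    fix x0 assume x0: "x0 \<in> space M"
    have nn: "0 \<le> f x0 t" for t using f_dens[OF x0] by simp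
    show "is_interval {\<tau>. 0 < f x0 \<tau>}"
      unfolding is_interval_1
    proof (intro ballI allI impI)
      fix t1 t2 t assume *: "t1 \<in> {\<tau>. 0 < f x0 \<tau>}" "t2 \<in> {\<tau>. 0 < f x0 \<tau>}" "t1 \<le> t \<and> t \<le> t2"
      show "t \<in> {\<tau>. 0 < f x0 \<tau>}"
      proof (rule ccontr)
        assume "t \<notin> {\<tau>. 0 < f x0 \<tau>}"
        then have "f x0 t = 0" using nn[of t] by simp
        moreover from this * have "t1 < t" "t < t2" by (auto simp: order_less_le)
        ultimately show False using no_zero[OF x0] * by auto
      qed
    qed
    show "\<not> (\<exists>\<tau>\<^sub>0\<in>frontier {\<tau>. 0 < f x0 \<tau>}. \<exists>c. bdd_meas M c
                 \<and> (\<exists>\<delta>>0. \<forall>x\<in>space M. \<delta> \<le> c x)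
                 \<and> (\<exists>K>0. \<exists>\<eta>>0. \<forall>\<omega>. \<bar>\<omega>\<bar> < \<eta> \<longrightarrow> (\<forall>x\<in>space M.
                      \<bar>f x (\<tau>\<^sub>0 + \<omega>) - c x * \<bar>\<omega>\<bar> powr (1/3)\<bar> \<le> K * \<bar>\<omega>\<bar> powr (2/3))))"
    proof
      assume "\<exists>\<tau>\<^sub>0\<in>frontier {\<tau>. 0 < f x0 \<tau>}. \<exists>c. bdd_meas M c
                 \<and> (\<exists>\<delta>>0. \<forall>x\<in>space M. \<delta> \<le> c x)
                 \<and> (\<exists>K>0. \<exists>\<eta>>0. \<forall>\<omega>. \<bar>\<omega>\<bar> < \<eta> \<longrightarrow> (\<forall>x\<in>space M.
                      \<bar>f x (\<tau>\<^sub>0 + \<omega>) - c x * \<bar>\<omega>\<bar> powr (1/3)\<bar> \<le> K * \<bar>\<omega>\<bar> powr (2/3)))"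
      then obtain \<tau> c \<delta> K \<eta> where \<delta>: "0 < \<delta>" "\<forall>x\<in>space M. \<delta> \<le> c x" and K: "0 < K" and \<eta>: "0 < \<eta>"
        and cusp: "\<forall>\<omega>. \<bar>\<omega>\<bar> < \<eta> \<longrightarrow> (\<forall>x\<in>space M.
                      \<bar>f x (\<tau> + \<omega>) - c x * \<bar>\<omega>\<bar> powr (1/3)\<bar> \<le> K * \<bar>\<omega>\<bar> powr (2/3))"
        by blast
      have c0: "\<delta> \<le> c x0" using \<delta> x0 by blast
      \<comment> \<open>At \<open>\<omega> = 0\<close> both powers are 0, so the expansion forces a
        zero.\<close>
      have zero: "f x0 \<tau> = 0" using cusp[rule_format, of 0 x0] \<eta> x0 by simp
      \<comment> \<open>The cube makes \<open>p\<close>, the cube root of \<omega>, at most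
        \<open>\<delta> / (2 * K)\<close>. The error \<open>K * (p * p)\<close> then stays below the
        main term \<open>c x0 * p\<close>, and the density is positive on both sides of the
        zero.\<close>
      define \<omega> where "\<omega> = min (\<eta> / 2) ((\<delta> / (2 * K)) ^ 3)"
      have \<omega>: "0 < \<omega>" "\<omega> < \<eta>" "\<omega> \<le> (\<delta> / (2 * K)) ^ 3" using \<eta> \<delta> K by (auto simp: \<omega>_def)
      define p where "p = \<omega> powr (1/3)"
      have p: "0 < p" using \<omega> by (simp add: p_def)
      have "\<omega> powr (2/3) = p * p" by (simp add: p_def flip: powr_add)
      have "p \<le> ((\<delta> / (2 * K)) ^ 3) powr (1/3)"
        unfolding p_def using \<omega> by (intro powr_mono2) auto
      also have "\<dots> = \<delta> / (2 * K)"
        using \<delta> K by (simp add: powr_powr flip: powr_numeral)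
      finally have "K * p \<le> \<delta> / 2" using K by (simp add: field_simps)
      then have "K * (p * p) < \<delta> * p"
        using p \<delta> mult_right_mono[of "K * p" "\<delta> / 2" p] by (simp add: mult.assoc)
      also have "\<dots> \<le> c x0 * p" using c0 p by simp
      finally have "K * (p * p) < c x0 * p" .
      moreover have "\<bar>f x0 (\<tau> + w) - c x0 * p\<bar> \<le> K * (p * p)" if "\<bar>w\<bar> = \<omega>" for w
        using cusp[rule_format, of w x0] that \<omega> x0 \<open>\<omega> powr (2/3) = p * p\<close> by (simp add: p_def)
      ultimately have pos: "0 < f x0 (\<tau> + w)" if "\<bar>w\<bar> = \<omega>" for w
        using that by fastforce
      show False
        using no_zero[OF x0 zero, of "\<tau> - \<omega>" "\<tau> + \<omega>"] pos[of \<omega>] pos[of "- \<omega>"] \<omega> by simp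
    qed
  qed
qed

end
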